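(* Let $b\ge 2$ be an integer and let $\varepsilon$ be a positive real number. For any positive integer $s$, there exists an integer $t_0$ such that, for any integer $t > t_0$, we have $$\liminf_{n \to +\infty} \frac{p\bigl(n, \log\bigl(1+\frac{s}{t}\bigr), b\bigr)}{n} \ge \frac{9}{8} - \varepsilon$$ and $$\liminf_{n \to +\infty} \frac{p\bigl(n, \sqrt{t^2-s^2}\,\arcsin\frac{s}{t}, b\bigr)}{n} \ge \frac{9}{8} - \varepsilon.$$
   Context: The $b$-ary expansion of a real number $\xi$ is the unique infinite sequence $(a_j)_{j\ge 1}$ of integers from $\{0,1,\ldots,b-1\}$ such that $\xi = \lfloor \xi \rfloor + \sum_{j\ge 1} a_j/b^j$ and $a_j \ne b-1$ for infinitely many indices $j$. For $n \ge 1$, $p(n,\xi,b)$ is the number of distinct blocks of length $n$ in this expansion: $p(n,\xi,b) = \#\{a_{j+1}a_{j+2}\cdots a_{j+n} : j \ge 0\}$. Here $\log$ is the natural logarithm. *)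

theory Defs
  imports "HOL-Analysis.Analysis"
begin

text \<open>
  Digit sequences are indexed from 0: \<open>a j\<close> is the digit usually written $a_{j+1}$,
  the coefficient of $b^{-(j+1)}$.
\<close>

definition is_bary_expansion :: "nat \<Rightarrow> real \<Rightarrow> (nat \<Rightarrow> nat) \<Rightarrow> bool" where
  "is_bary_expansion b \<xi> a \<longleftrightarrow>
     (\<forall>j. a j \<in> {0..b - 1}) \<and>
     \<xi> = of_int \<lfloor>\<xi>\<rfloor> + (\<Sum>j. real (a j) / real b ^ Suc j) \<and>
     infinite {j. a j \<noteq> b - 1}"

definition bary_expansion :: "nat \<Rightarrow> real \<Rightarrow> nat \<Rightarrow> nat" where
  "bary_expansion b \<xi> = (THE a. is_bary_expansion b \<xi> a)"

definition block_complexity :: "nat \<Rightarrow> real \<Rightarrow> nat \<Rightarrow> nat" where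
  "block_complexity n \<xi> b =
     card {map (\<lambda>i. bary_expansion b \<xi> (j + i)) [0..<n] | j. True}"

subsection \<open>Existence and uniqueness of the expansion\<close>

lemma digit_series_summable:
  fixes a :: "nat \<Rightarrow> nat"
  assumes b: "b \<ge> 2" and a: "\<And>j. a j \<le> b - 1"
  shows "summable (\<lambda>j. real (a j) / real b ^ Suc j)"
proof (rule summable_comparison_test'[where N = 0])
  show "summable (\<lambda>j. (1 / real b) ^ j)"
    by (rule summable_geometric) (use b in auto)
  fix j :: nat
  have "real (a j) \<le> real b" using a[of j] by linarith
  then have "real (a j) / real b ^ Suc j \<le> real b / real b ^ Suc j"
    by (intro divide_right_mono) auto
  then show "norm (real (a j) / real b ^ Suc j) \<le> (1 / real b) ^ j"
    using b by (simp add: power_divide)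
qed

lemma maximal_digit_series:
  assumes b: "b \<ge> (2::nat)"
  shows "(\<lambda>j. real (b - 1) / real b ^ Suc j) sums 1"
proof -
  have "(\<lambda>j. (real (b - 1) / real b) * (1 / real b) ^ j) sums
          ((real (b - 1) / real b) * (1 / (1 - 1 / real b)))"
    by (intro sums_mult geometric_sums) (use b in auto)
  moreover have "(real (b - 1) / real b) * (1 / (1 - 1 / real b)) = 1"
    using b by (simp add: field_simps of_nat_diff)
  ultimately show ?thesis using b by (auto simp: power_divide)
qed

lemma digit_series_bounds:
  fixes a :: "nat \<Rightarrow> nat"
  assumes b: "b \<ge> 2" and a: "\<And>j. a j \<le> b - 1" and inf: "infinite {j. a j \<noteq> b - 1}"
  defines "T \<equiv> \<lambda>N. \<Sum>j. real (a (j + N)) / real b ^ Suc j"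
  shows "0 \<le> T N" "T N < 1" "real b * T N = real (a N) + T (Suc N)"
proof -
  have sm: "summable (\<lambda>j. real (a (j + N)) / real b ^ Suc j)" for N
    by (rule digit_series_summable[OF b]) (rule a)
  show "0 \<le> T N" unfolding T_def by (rule suminf_nonneg[OF sm]) simp
  let ?d = "\<lambda>j. real (b - 1) / real b ^ Suc j - real (a (j + N)) / real b ^ Suc j"
  obtain k where k: "k \<ge> N" "a k \<noteq> b - 1"
    using inf unfolding infinite_nat_iff_unbounded_le by auto
  have "0 < suminf ?d"
  proof (rule suminf_pos2)
    show "summable ?d"
      by (intro summable_diff sm sums_summable[OF maximal_digit_series[OF b]])
    show "0 \<le> ?d j" for j
      using divide_right_mono[of "real (a (j + N))" "real (b - 1)" "real b ^ Suc j"] a[of "j + N"]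
      by simp
    have "real (a k) < real (b - 1)" using k(2) a[of k] by simp
    then have "real (a k) / real b ^ Suc (k - N) < real (b - 1) / real b ^ Suc (k - N)"
      using b by (intro divide_strict_right_mono) auto
    then show "0 < ?d (k - N)" using k(1) by simp
  qed
  also have "suminf ?d = 1 - T N"
    unfolding T_def
    using suminf_diff[OF sums_summable[OF maximal_digit_series[OF b]] sm]
      sums_unique[OF maximal_digit_series[OF b]] by simp
  finally show "T N < 1" by simp
  have "T N = real (a N) / real b + (\<Sum>j. real (a (Suc j + N)) / real b ^ Suc (Suc j))"
    unfolding T_def using suminf_split_head[OF sm[of N]] by simp
  also have "(\<Sum>j. real (a (Suc j + N)) / real b ^ Suc (Suc j)) =
             (\<Sum>j. (real (a (j + Suc N)) / real b ^ Suc j) / real b)"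
    by (simp add: mult_ac)
  also have "\<dots> = T (Suc N) / real b"
    unfolding T_def by (rule suminf_divide[OF sm])
  finally show "real b * T N = real (a N) + T (Suc N)"
    using b by (simp add: field_simps)
qed

lemma bary_expansion_ex:
  assumes b: "b \<ge> (2::nat)"
  shows "\<exists>a. is_bary_expansion b \<xi> a"
proof -
  define f where "f N = rec_nat (frac \<xi>) (\<lambda>_ x. frac (real b * x)) N" for N
  have f0: "f 0 = frac \<xi>" and fS: "f (Suc N) = frac (real b * f N)" for N
    by (simp_all add: f_def)
  have f_bounds: "0 \<le> f N \<and> f N < 1" for N
    by (cases N) (simp_all add: f0 fS frac_lt_1)
  define a where "a N = nat \<lfloor>real b * f N\<rfloor>" for N
  have step: "real b * f N = real (a N) + f (Suc N)" for N
  proof -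
    have "0 \<le> \<lfloor>real b * f N\<rfloor>" using f_bounds[of N] by simp
    then show ?thesis unfolding a_def fS frac_def by simp
  qed
  have a_le: "a N \<le> b - 1" for N
  proof -
    have "real b * f N < real b" using f_bounds[of N] b by simp
    then have "real (a N) < real b" using step[of N] f_bounds[of "Suc N"] by linarith
    then show ?thesis by simp
  qed
  have partial: "(\<Sum>j<n. real (a (j + N)) / real b ^ Suc j) = f N - f (N + n) / real b ^ n" for n N
  proof (induction n)
    case (Suc n)
    have "f (N + n) / real b ^ n = (real b * f (N + n)) / real b ^ Suc n" using b by simp
    also have "\<dots> = real (a (n + N)) / real b ^ Suc n + f (N + Suc n) / real b ^ Suc n"
      unfolding step by (simp add: add_divide_distrib add.commute)
    finally show ?case using Suc by simp
  qed simp
  have sums: "(\<lambda>j. real (a (j + N)) / real b ^ Suc j) sums f N" for N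
  proof -
    have "(\<lambda>n. (1 / real b) ^ n) \<longlonglongrightarrow> 0"
      by (rule LIMSEQ_power_zero) (use b in auto)
    then have "(\<lambda>n. f (N + n) / real b ^ n) \<longlonglongrightarrow> 0"
    proof (rule tendsto_sandwich[OF _ _ tendsto_const, rotated 2])
      show "\<forall>\<^sub>F n in sequentially. 0 \<le> f (N + n) / real b ^ n"
        using f_bounds by simp
      show "\<forall>\<^sub>F n in sequentially. f (N + n) / real b ^ n \<le> (1 / real b) ^ n"
      proof (rule always_eventually, rule allI)
        fix n
        have "f (N + n) / real b ^ n \<le> 1 / real b ^ n"
          using f_bounds[of "N + n"] by (intro divide_right_mono) auto
        then show "f (N + n) / real b ^ n \<le> (1 / real b) ^ n" by (simp add: power_divide)
      qed
    qed
    then have "(\<lambda>n. f N - f (N + n) / real b ^ n) \<longlonglongrightarrow> f N - 0"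
      by (intro tendsto_diff tendsto_const)
    then show ?thesis unfolding sums_def partial by simp
  qed
  have "infinite {j. a j \<noteq> b - 1}"
  proof
    assume "finite {j. a j \<noteq> b - 1}"
    then obtain N where "\<forall>j \<in> {j. a j \<noteq> b - 1}. j < N"
      using finite_nat_set_iff_bounded by blast
    then have "a (j + N) = b - 1" for j by (auto simp: not_less[symmetric])
    then have "(\<lambda>j. real (b - 1) / real b ^ Suc j) sums f N" using sums[of N] by simp
    then have "f N = 1" using maximal_digit_series[OF b] sums_unique2 by blast
    then show False using f_bounds[of N] by simp
  qed
  moreover have "\<xi> = of_int \<lfloor>\<xi>\<rfloor> + (\<Sum>j. real (a j) / real b ^ Suc j)"
    using sums_unique[OF sums[of 0]] by (simp add: f0 frac_def)
  ultimately show ?thesis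
    unfolding is_bary_expansion_def using a_le by (intro exI[of _ a]) auto
qed

lemma bary_expansion_unique:
  assumes b: "b \<ge> (2::nat)" and "is_bary_expansion b \<xi> a" "is_bary_expansion b \<xi> a'"
  shows "a = a'"
proof -
  define T where "T c N = (\<Sum>j. real (c (j + N)) / real b ^ Suc j)" for c :: "nat \<Rightarrow> nat" and N
  have a: "\<And>j. a j \<le> b - 1" "infinite {j. a j \<noteq> b - 1}" "T a 0 = \<xi> - of_int \<lfloor>\<xi>\<rfloor>"
    and a': "\<And>j. a' j \<le> b - 1" "infinite {j. a' j \<noteq> b - 1}" "T a' 0 = \<xi> - of_int \<lfloor>\<xi>\<rfloor>"
    using assms(2,3) unfolding is_bary_expansion_def T_def by auto
  note B = digit_series_bounds[OF b a(1,2), folded T_def]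
  note B' = digit_series_bounds[OF b a'(1,2), folded T_def]
  have step: "a N = a' N \<and> T a (Suc N) = T a' (Suc N)" if "T a N = T a' N" for N
  proof -
    have eq: "real (a N) + T a (Suc N) = real (a' N) + T a' (Suc N)"
      using B(3)[of N] B'(3)[of N] that by simp
    then have "real (a N) < real (a' N) + 1" "real (a' N) < real (a N) + 1"
      using B(1,2)[of "Suc N"] B'(1,2)[of "Suc N"] by linarith+
    then have "a N = a' N" by linarith
    then show ?thesis using eq by simp
  qed
  have "T a N = T a' N" for N
    by (induction N) (use a(3) a'(3) step in auto)
  then show ?thesis using step by auto
qed

lemma is_bary_expansion_bary_expansion:
  assumes "b \<ge> (2::nat)"
  shows "is_bary_expansion b \<xi> (bary_expansion b \<xi>)"
  unfolding bary_expansion_def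
  using bary_expansion_ex[OF assms] bary_expansion_unique[OF assms] by (metis theI)

end

theory Submission
  imports Defs "HOL-Computational_Algebra.Primes"
begin

text \<open>
  Both numbers have irrationality exponent close to 2 when \<open>t\<close> is large, and the expansion of
  a number with irrationality exponent close to 2 in any base must have many blocks.

  From the number to its digits. If the digits at the positions \<open>i < j\<close> begin with the same
  block of length \<open>L\<close>, then \<open>b^j \<xi> - b^i \<xi>\<close> is within \<open>b^-L\<close> of an integer. When
  \<open>|q \<xi> - p| \<ge> c q^(-1.01)\<close> for all \<open>q \<ge> 1\<close>, this forces \<open>L \<le> 1.01 j + C\<close>
  (\<open>repetition_bound_from_measure\<close>): a block of length \<open>L\<close> cannot return much before position \<open>L\<close>.

  From the digits to the complexity. Let \<open>p(n)\<close> be the number of blocks of length \<open>n\<close>. It is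
  strictly increasing, and the lengths where it grows by at least 2 can only help. At a length
  \<open>m\<close> with \<open>p(m+1) = p(m) + 1\<close> only one block can be continued by two different letters. Hence the
  word walks along an initial path of some length \<open>k\<close> to this block and then along loops of two
  types, of lengths \<open>a\<close> and \<open>b\<close>. All three paths end at the same vertex, so they may share final
  segments, and \<open>p(m)\<close> is \<open>k + a + b\<close> up to the length of these overlaps (\<open>card_blocks_ge\<close>).
  The loops are long, \<open>a + b > m\<close> (\<open>loops_long\<close>), since a block with two short periods
  has only one periodic continuation. The bound on repetitions, applied to the first few loops of
  the walk, gives four more linear inequalities. Together they exclude \<open>p(m) < 1.13 m\<close>
  (\<open>complexity_at_unit_slope\<close>), and therefore \<open>p(n) \<ge> 9n/8\<close> for all large \<open>n\<close>.

  The irrationality measure. For \<open>\<alpha> = 1\<close> and \<open>\<alpha> = 1/2\<close> consider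
  \<open>F(z) = \<Sum>i. i! / (\<alpha> (\<alpha>+1) ... (\<alpha>+i)) z^i\<close>, which is the integral of
  \<open>w^(\<alpha>-1) / (1 - z (1 - w))\<close> over \<open>0 < w < 1\<close>. The logarithm is \<open>z F(z)\<close> with \<open>\<alpha> = 1\<close> and
  \<open>z = s/(s+t)\<close>, and the other number is a rational multiple of \<open>z F(z)\<close> with \<open>\<alpha> = 1/2\<close> and
  \<open>z = s^2/t^2\<close>. Integrating the Jacobi polynomial of degree \<open>n\<close> for the weight \<open>w^(\<alpha>-1)\<close> against
  the same kernel gives a linear form in 1 and \<open>F(z)\<close>. By orthogonality only the powers \<open>z^i\<close> with
  \<open>i \<ge> n\<close> survive, all with positive coefficients, so the form is of size \<open>z^n\<close> from above and
  below. Its coefficients become integers after multiplication by a power of the denominator \<open>N\<close>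
  of \<open>z\<close> and by a common multiple of \<open>1, ..., 2n\<close>, which can be chosen at most \<open>256^n\<close>
  (\<open>small_common_multiple\<close>). Up to factors \<open>K^n\<close>, where \<open>K\<close> depends only on \<open>s\<close>, the coefficients
  have size \<open>N^n\<close> and the forms have size \<open>N^-n\<close>, so a bound \<open>|q \<xi> - p| \<ge> c q^(-1.01)\<close>
  follows as soon as \<open>N\<close> is large compared with \<open>K\<close> (\<open>irrationality_measure_criterion\<close>, \<open>beta_series_measure\<close>).
\<close>

section \<open>Agreement of a word with its shifts\<close>

definition block :: "(nat \<Rightarrow> 'a) \<Rightarrow> nat \<Rightarrow> nat \<Rightarrow> 'a list" where
  "block x n j = map (\<lambda>i. x (j + i)) [0..<n]"

definition agree :: "(nat \<Rightarrow> 'a) \<Rightarrow> nat \<Rightarrow> nat \<Rightarrow> nat \<Rightarrow> bool" where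
  "agree x i j L \<longleftrightarrow> (\<forall>l<L. x (i + l) = x (j + l))"

lemma block_eq_iff: "block x n i = block x n j \<longleftrightarrow> agree x i j n"
  by (auto simp: block_def agree_def)

lemma agree_refl [simp]: "agree x i i L"
  by (simp add: agree_def)

lemma agree_sym: "agree x i j L \<Longrightarrow> agree x j i L"
  by (simp add: agree_def)

lemma agree_trans: "agree x i j L \<Longrightarrow> agree x j h L \<Longrightarrow> agree x i h L"
  by (simp add: agree_def)

lemma agree_mono: "agree x i j L \<Longrightarrow> L' \<le> L \<Longrightarrow> agree x i j L'"
  by (simp add: agree_def)

lemma agree_shift:
  assumes "agree x i j L" "s + L' \<le> L"
  shows "agree x (i + s) (j + s) L'"
  using assms by (auto simp: agree_def add.assoc)

lemma agree_Suc: "agree x i j (Suc L) \<longleftrightarrow> agree x i j L \<and> x (i + L) = x (j + L)"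
  by (auto simp: agree_def less_Suc_eq)

lemma agree_Suc_iff_shift:
  assumes "agree x i j (m + s)"
  shows "agree x i j (m + Suc s) \<longleftrightarrow> agree x (i + s) (j + s) (Suc m)"
proof -
  have "agree x (i + s) (j + s) m" using agree_shift[OF assms, of s m] by simp
  then show ?thesis using assms by (simp add: agree_Suc ac_simps)
qed

text \<open>
  A weak form of the theorem of Fine and Wilf. If a word \<open>W\<close> of length \<open>L \<ge> a + b\<close> has periods
  \<open>a\<close> and \<open>b\<close>, then the letter after it is the same whichever period is continued: both \<open>W ! (L - a)\<close>
  and \<open>W ! (L - b)\<close> equal \<open>W ! (L - a - b)\<close>.
\<close>
lemma periods_determine_next_letter:
  assumes u: "agree x u (u + a) L" and v: "agree x v (v + b) L" and uv: "agree x u v L"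
    and neq: "x (u + L) \<noteq> x (v + L)" and pos: "a > 0" "b > 0"
  shows "a + b > L"
proof (rule ccontr)
  assume "\<not> a + b > L"
  then have le: "a + b \<le> L" by simp
  have U: "x (u + l) = x (u + a + l)" and V: "x (v + l) = x (v + b + l)" and E: "x (u + l) = x (v + l)"
    if "l < L" for l using u v uv that by (auto simp: agree_def)
  have "x (u + L) = x (u + (L - a))" using U[of "L - a"] le pos by simp
  also have "\<dots> = x (v + (L - a))" using E[of "L - a"] le pos by simp
  also have "\<dots> = x (v + (L - a - b))" using V[of "L - a - b"] le pos by simp
  also have "\<dots> = x (u + (L - a - b))" using E[of "L - a - b"] le pos by simp
  also have "\<dots> = x (u + (L - b))" using U[of "L - a - b"] le pos by (simp add: add.commute diff_diff_left)
  also have "\<dots> = x (v + (L - b))" using E[of "L - b"] le pos by simp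
  also have "\<dots> = x (v + L)" using V[of "L - b"] le pos by simp
  finally show False using neq by simp
qed

lemma greatest_nat:
  fixes P :: "nat \<Rightarrow> bool"
  assumes "P i" "\<And>j. P j \<Longrightarrow> j \<le> B"
  obtains c where "P c" "\<And>j. P j \<Longrightarrow> j \<le> c"
  using assms GreatestI_nat[of P i B] Greatest_le_nat[of P _ B] by blast

section \<open>The walk of a word through its blocks\<close>

text \<open>
  The linear programme behind the lower bound. The meaning of the variables is that of the locale
  \<open>fork_graph\<close> below, where \<open>c0\<close>, \<open>c1\<close>, \<open>c2\<close> are the lengths of the final segments common to the
  initial path and the first loop, to the initial path and the second loop, and to the two loops.
  The summands \<open>m / 100\<close> and the difference between 1131/1000 and 113/100 make room for error terms.
\<close>
lemma fork_inequalities_inconsistent: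
  fixes k a b q q' c0 c1 c2 m :: real
  assumes nonneg: "m > 0" "k \<ge> 0" "a \<ge> 0" "b \<ge> 0" "c0 \<ge> 0" "c1 \<ge> 0" "c2 \<ge> 0"
    and le: "c1 \<le> b" "c2 \<le> b"
    and first: "c0 + m + (q - k) - a \<le> 101/100 * (k + a - c0) + 1/100 * m"
    and before: "c1 + m \<le> 101/100 * (q + b - c1) + 1/100 * m"
    and loops: "m + c2 \<le> a + b"
    and count: "k + a + b - c0 - max c1 c2 \<le> 1131/1000 * m"
    and cases: "q = k + a \<and> c2 + m + (q' - q) - b \<le> 101/100 * (q + b - c2) + 1/100 * m
        \<and> c1 + m + a \<le> 101/100 * (q' - c1) + 1/100 * m \<or> q \<ge> k + 2 * a"
  shows False
proof -
  note lin = nonneg le loops first[unfolded distrib_left right_diff_distrib]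
    before[unfolded distrib_left right_diff_distrib]
  from cases show ?thesis
  proof (elim disjE conjE)
    assume q: "q = k + a"
      and "c2 + m + (q' - q) - b \<le> 101/100 * (q + b - c2) + 1/100 * m"
      and "c1 + m + a \<le> 101/100 * (q' - c1) + 1/100 * m"
    note lin = lin q this(2,3)[unfolded distrib_left right_diff_distrib]
    show False
    proof (cases "c1 \<le> c2")
      case True
      then have "k + a + b - c0 - c2 \<le> 1131/1000 * m" using count by simp
      with lin show ?thesis by linarith
    next
      case False
      then have "k + a + b - c0 - c1 \<le> 1131/1000 * m" using count by simp
      with lin show ?thesis by linarith
    qed
  next
    assume q: "q \<ge> k + 2 * a"
    show False
    proof (cases "c1 \<le> c2")
      case True
      then have "k + a + b - c0 - c2 \<le> 1131/1000 * m" using count by simp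
      with lin q show ?thesis by linarith
    next
      case False
      then have "k + a + b - c0 - c1 \<le> 1131/1000 * m" using count by simp
      with lin q show ?thesis by linarith
    qed
  qed
qed

text \<open>
  The situation at a length \<open>m\<close> where exactly one block can be continued by two letters. The
  position \<open>k\<close> is the first one at which this block occurs, and \<open>q\<close> is the first position
  where it is followed by the other letter than at \<open>k\<close>. By \<open>det\<close>, equal blocks of length \<open>m\<close> have
  equal continuations except at occurrences of this block.
\<close>
locale fork_graph =
  fixes x :: "nat \<Rightarrow> 'a" and m k q :: nat
  assumes kq: "agree x k q m" and letters: "x (k + m) \<noteq> x (q + m)"
    and det: "\<And>i j. agree x i j m \<Longrightarrow> \<not> agree x i j (Suc m) \<Longrightarrow>
        agree x k i (Suc m) \<and> agree x q j (Suc m) \<or> agree x q i (Suc m) \<and> agree x k j (Suc m)"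
    and k_first: "\<And>i. agree x k i m \<Longrightarrow> k \<le> i"
    and q_first: "\<And>i. agree x q i (Suc m) \<Longrightarrow> q \<le> i"
    and k_rec: "\<And>N. \<exists>i\<ge>N. agree x k i (Suc m)"
begin

text \<open>
  Occurrences of the branching block, sorted by the letter that follows.
\<close>
definition fork1 where "fork1 i \<longleftrightarrow> agree x k i (Suc m)"
definition fork2 where "fork2 i \<longleftrightarrow> agree x q i (Suc m)"
definition fork where "fork i \<longleftrightarrow> agree x k i m"

lemma fork_k: "fork k" "fork1 k" "fork2 q" "fork q"
  using kq by (simp_all add: fork_def fork1_def fork2_def)

lemma fork_iff: "fork i \<longleftrightarrow> fork1 i \<or> fork2 i"
proof
  assume "fork i"
  then show "fork1 i \<or> fork2 i"
    using det[of k i] letters unfolding fork_def fork1_def fork2_def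
    by (metis agree_Suc)
next
  assume "fork1 i \<or> fork2 i"
  then show "fork i" using kq unfolding fork_def fork1_def fork2_def
    by (metis agree_Suc agree_trans)
qed

lemma not_fork12: "\<not> (fork1 i \<and> fork2 i)"
  using letters unfolding fork1_def fork2_def agree_Suc by metis

lemma k_less_q: "k < q"
  using k_first[OF kq] letters by (cases "k = q") auto

lemma fork_agree: "fork i \<Longrightarrow> fork j \<Longrightarrow> agree x i j m"
  unfolding fork_def by (metis agree_sym agree_trans)

lemma fork_transfer: "fork i \<Longrightarrow> agree x i j m \<Longrightarrow> fork j"
  unfolding fork_def by (metis agree_trans)

text \<open>
  The working principle of the whole section: an agreement of length at least \<open>m\<close> continues as
  long as the two walks do not leave the branching block in different directions.
\<close>
lemma agree_extend:
  assumes "agree x i j (m + s)" "s \<le> e"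
    and "\<And>l. s \<le> l \<Longrightarrow> l < e \<Longrightarrow> \<not> (fork1 (i + l) \<and> fork2 (j + l)) \<and> \<not> (fork2 (i + l) \<and> fork1 (j + l))"
  shows "agree x i j (m + e)"
  using assms(2,3)
proof (induction e rule: dec_induct)
  case base
  then show ?case using assms(1) by simp
next
  case (step n)
  then have A: "agree x i j (m + n)" by simp
  have "agree x (i + n) (j + n) m" using agree_shift[OF A, of n m] by simp
  then have "agree x (i + n) (j + n) (Suc m)"
    using det[of "i + n" "j + n"] step.prems[of n] step.hyps unfolding fork1_def fork2_def by auto
  then show ?case using agree_Suc_iff_shift[OF A] by simp
qed

lemma agree_until_fork:
  assumes "agree x i j m" "\<And>l. l < c \<Longrightarrow> \<not> fork (i + l)"
  shows "agree x i j (m + c)"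
  by (rule agree_extend[where s = 0]) (use assms fork_iff in auto)

text \<open>
  The distance to the next occurrence of the branching block. It is meant for occurrences \<open>p\<close>, where
  by \<open>loop_eq\<close> it depends only on the letter that follows.
\<close>
definition loop where "loop p = (LEAST t. 0 < t \<and> fork (p + t))"

lemma loop: "0 < loop p" "fork (p + loop p)" "0 < t \<Longrightarrow> t < loop p \<Longrightarrow> \<not> fork (p + t)"
proof -
  obtain j where "j \<ge> Suc p" "fork1 j" using k_rec unfolding fork1_def by blast
  then have "0 < j - p \<and> fork (p + (j - p))" using fork_iff by simp
  then have "0 < loop p \<and> fork (p + loop p)" unfolding loop_def by (rule LeastI)
  then show "0 < loop p" "fork (p + loop p)" by auto
  show "\<not> fork (p + t)" if "0 < t" "t < loop p"
    using not_less_Least[of t "\<lambda>t. 0 < t \<and> fork (p + t)"] that unfolding loop_def by auto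
qed

lemma no_fork_inside: "p < i \<Longrightarrow> i < p + loop p \<Longrightarrow> \<not> fork i"
  using loop(3)[of "i - p" p] by simp

lemma loop_agree:
  assumes "agree x p i (Suc m)"
  shows "agree x p i (m + loop p)"
proof -
  have "agree x p i (m + 1)" using assms by simp
  then show ?thesis
  proof (rule agree_extend)
    show "1 \<le> loop p" using loop(1)[of p] by simp
    show "\<not> (fork1 (p + l) \<and> fork2 (i + l)) \<and> \<not> (fork2 (p + l) \<and> fork1 (i + l))"
      if "1 \<le> l" "l < loop p" for l
      using no_fork_inside[of p "p + l"] that fork_iff by auto
  qed
qed

lemma loop_eq:
  assumes "agree x p i (Suc m)"
  shows "loop i = loop p"
proof -
  have A: "agree x p i (m + loop p)" by (rule loop_agree[OF assms])
  have T: "fork (p + t) \<longleftrightarrow> fork (i + t)" if "t \<le> loop p" for t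
  proof -
    have "agree x (p + t) (i + t) m" using agree_shift[OF A, of t m] that by simp
    then show ?thesis using fork_transfer agree_sym by metis
  qed
  show ?thesis
  proof (rule antisym)
    show "loop i \<le> loop p"
      using T[of "loop p"] loop(2)[of p] loop(1)[of p] no_fork_inside[of i "i + loop p"]
      by (cases "loop i \<le> loop p") auto
    show "loop p \<le> loop i"
      using T[of "loop i"] loop(2)[of i] loop(1)[of i] no_fork_inside[of p "p + loop i"]
      by (cases "loop p \<le> loop i") auto
  qed
qed

abbreviation "a \<equiv> loop k"
abbreviation "b \<equiv> loop q"

lemma loop1: "fork1 i \<Longrightarrow> loop i = a" and loop2: "fork2 i \<Longrightarrow> loop i = b"
  unfolding fork1_def fork2_def by (rule loop_eq, assumption)+

lemma previous_fork:
  assumes "fork p" "fork r" "r < p"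
  obtains r' where "r \<le> r'" "r' < p" "fork r'" "r' + loop r' = p"
proof -
  obtain r' where r': "r' < p \<and> fork r'" "\<And>j. j < p \<and> fork j \<Longrightarrow> j \<le> r'"
    by (rule greatest_nat[of "\<lambda>j. j < p \<and> fork j" r p]) (use assms in auto)
  have e: "r' + loop r' = p"
  proof (rule ccontr)
    assume n: "r' + loop r' \<noteq> p"
    show False
    proof (cases "r' + loop r' < p")
      case True
      then show False using r'(2)[of "r' + loop r'"] loop[of r'] by auto
    next
      case False
      then show False using no_fork_inside[of r' p] assms r'(1) n by auto
    qed
  qed
  have "r \<le> r'" using r'(2) assms by blast
  then show thesis using r'(1) by (intro that[OF _ _ _ e]) auto
qed

lemma no_fork_before_k: "i < k \<Longrightarrow> \<not> fork i"
  using k_first[of i] unfolding fork_def by auto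

lemma no_fork2_before_q: "i < q \<Longrightarrow> \<not> fork2 i"
  using q_first[of i] unfolding fork2_def by auto

text \<open>
  From \<open>k\<close> up to \<open>q\<close> only the first loop is run through, either once or at least twice.
\<close>
lemma q_position: "q = k + a \<or> fork1 (k + a) \<and> k + 2 * a \<le> q"
proof (cases "fork2 (k + a)")
  case True
  have "\<not> (q < k + a)"
    using no_fork_inside[of k q] k_less_q fork_k by auto
  then show ?thesis using no_fork2_before_q[of "k + a"] True by auto
next
  case False
  then have f: "fork1 (k + a)" using loop(2)[of k] fork_iff by auto
  have "q \<noteq> k + a" using False fork_k by auto
  moreover have "\<not> (q < k + a)"
    using no_fork_inside[of k q] k_less_q fork_k by auto
  moreover have "\<not> (k + a < q \<and> q < k + a + a)"
    using no_fork_inside[of "k + a" q] loop1[OF f] fork_k by auto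
  ultimately show ?thesis using f by linarith
qed

text \<open>
  Up to \<open>q\<close> the word has period \<open>a\<close>, from \<open>k\<close> on because only the first loop is used, and already
  from \<open>k - c0\<close> on if the initial path and the first loop have their last \<open>c0\<close> steps in common.
\<close>
lemma first_run:
  assumes "c0 \<le> k" "agree x (k - c0) (k + a - c0) m" "k + a \<le> q"
  shows "agree x (k - c0) (k + a - c0) (c0 + m + (q - k) - a)"
proof -
  have "agree x (k - c0) (k + a - c0) (m + (c0 + (q - k) - a))"
  proof (rule agree_extend[where s = 0], goal_cases)
    case (3 l)
    have "k - c0 + l < q" "k + a - c0 + l < q" using 3(2) assms(1,3) loop(1)[of k] by linarith+
    then have "\<not> fork2 (k - c0 + l)" "\<not> fork2 (k + a - c0 + l)"
      using no_fork2_before_q by blast+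
    then show ?case by auto
  qed (use assms in auto)
  moreover have "m + (c0 + (q - k) - a) = c0 + m + (q - k) - a" using assms by simp
  ultimately show ?thesis by simp
qed

text \<open>
  The end of the first run through second loops.
\<close>
definition q' where "q' = (LEAST i. q < i \<and> fork1 i)"

lemma q': "q < q'" "fork1 q'" "q \<le> i \<Longrightarrow> i < q' \<Longrightarrow> \<not> fork1 i"
proof -
  obtain j where "j \<ge> Suc q" "fork1 j" using k_rec unfolding fork1_def by blast
  then have "q < j \<and> fork1 j" by simp
  then have "q < q' \<and> fork1 q'" unfolding q'_def by (rule LeastI)
  then show "q < q'" "fork1 q'" by auto
  show "\<not> fork1 i" if "q \<le> i" "i < q'"
    using not_less_Least[of i "\<lambda>i. q < i \<and> fork1 i"] that not_fork12[of q] fork_k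
    unfolding q'_def by (cases "i = q") auto
qed

lemma q'_ge: "q + b \<le> q'"
  using no_fork_inside[of q q'] q'(1,2) fork_iff by (cases "q' < q + b") auto

text \<open>
  The analogue of \<open>first_run\<close> for the second loops between \<open>q\<close> and \<open>q'\<close>.
\<close>
lemma second_run:
  assumes "c2 < b" "c2 \<le> q" "agree x (q - c2) (q + b - c2) m"
  shows "agree x (q - c2) (q + b - c2) (c2 + m + (q' - q) - b)"
proof -
  have "agree x (q - c2) (q + b - c2) (m + (c2 + (q' - q) - b))"
  proof (rule agree_extend[where s = 0], goal_cases)
    case (3 l)
    show ?case
    proof (cases "l < c2")
      case True
      then show ?thesis using no_fork_inside[of q "q + b - c2 + l"] assms fork_iff by auto
    next
      case False
      have "q \<le> q - c2 + l" "q - c2 + l < q'" "q \<le> q + b - c2 + l" "q + b - c2 + l < q'"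
        using 3(2) assms(1,2) False q'_ge loop(1)[of q] by linarith+
      then have "\<not> fork1 (q - c2 + l)" "\<not> fork1 (q + b - c2 + l)"
        using q'(3) by blast+
      then show ?thesis by auto
    qed
  qed (use assms in auto)
  moreover have "m + (c2 + (q' - q) - b) = c2 + m + (q' - q) - b" using q'_ge by simp
  ultimately show ?thesis by simp
qed

lemma last_second_loop: obtains r where "fork2 r" "r + b = q'" "q \<le> r"
proof -
  have "fork q'" using q' fork_iff by auto
  obtain r where r: "q \<le> r" "r < q'" "fork r" "r + loop r = q'"
    using previous_fork[OF \<open>fork q'\<close> fork_k(4) q'(1)] by auto
  then have f: "fork2 r" using q'(3)[of r] fork_iff by auto
  have "r + b = q'" using r(4) unfolding loop2[OF f] .
  then show thesis by (rule that[OF f _ r(1)])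
qed

lemma before_second_run:
  assumes "c \<le> b"
  shows "agree x (q + b - c) (q' - c) (m + c)"
proof -
  obtain r where r: "fork2 r" "r + b = q'" "q \<le> r" by (rule last_second_loop)
  have A: "agree x q r (m + b)" using loop_agree[of q r] r(1) unfolding fork2_def by simp
  have "q + (b - c) = q + b - c" "r + (b - c) = q' - c" using r(2) assms by linarith+
  then show ?thesis using agree_shift[OF A, of "b - c" "m + c"] assms by simp
qed

text \<open>
  At \<open>q'\<close> the walk comes out of a second loop and enters a first one, as it does at \<open>k\<close>, where it
  comes out of the initial path.
\<close>
lemma third_run:
  assumes "c1 \<le> k" "c1 < b" "agree x (k - c1) (q + b - c1) m"
  shows "agree x (k - c1) (q' - c1) (c1 + m + a)"
proof -
  have "agree x (q + b - c1) (q' - c1) m"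
    using before_second_run[of c1] assms agree_mono[of _ _ _ "m + c1" m] by simp
  then have 0: "agree x (k - c1) (q' - c1) m" using assms agree_trans by metis
  have "agree x (k - c1) (q' - c1) (m + (c1 + a))"
  proof (rule agree_extend[where s = 0], goal_cases)
    case (3 l)
    note l = this
    consider "l < c1" | "l = c1" | "l > c1" by linarith
    then show ?case
    proof cases
      case 1
      then show ?thesis using no_fork_before_k[of "k - c1 + l"] assms fork_iff by auto
    next
      case 2
      then show ?thesis using fork_k q' not_fork12 assms q'_ge by auto
    next
      case 3
      then show ?thesis
        using no_fork_inside[of k "k - c1 + l"] assms(1) l fork_iff by auto
    qed
  qed (use 0 in auto)
  then show ?thesis by (simp add: ac_simps)
qed

text \<open>
  The initial path contains no branching, so a block on it determines the word up to the end of
  the branching block at \<open>k\<close>.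
\<close>
lemma before_k:
  assumes "c1 \<le> k" "agree x (k - c1) j m"
  shows "agree x (k - c1) j (m + c1)"
  by (rule agree_until_fork) (use assms no_fork_before_k in auto)

text \<open>
  Let \<open>W\<close> be the branching block together with the \<open>c2\<close> letters that precede it at the end of either
  loop. As it reappears after either loop, it has the periods \<open>a\<close> and \<open>b\<close>; but it is followed by
  different letters, so that \<open>periods_determine_next_letter\<close> applies. The proof has to find an
  occurrence of \<open>W\<close> before a first loop and one before a second loop: if the first run consists of
  one loop, they are at \<open>q'\<close> and \<open>q\<close>, otherwise at \<open>k + a\<close> and \<open>q\<close>.
\<close>
lemma loops_long:
  assumes "c2 < a" "c2 < b" "agree x (k + a - c2) (q + b - c2) m"
  shows "m + c2 < a + b"
proof -
  have kq: "k + a \<le> q" using q_position by auto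
  have W: "agree x (k + a - c2) (q + b - c2) (m + c2)"
  proof (rule agree_until_fork)
    show "\<not> fork (k + a - c2 + l)" if "l < c2" for l
      using no_fork_inside[of k "k + a - c2 + l"] that assms by auto
  qed (use assms in simp)
  have A: "agree x (k + a - c2) (r + a - c2) (m + c2)" if "fork1 r" for r
  proof -
    have A: "agree x k r (m + a)" using loop_agree[of k r] that unfolding fork1_def by simp
    have "k + (a - c2) = k + a - c2" "r + (a - c2) = r + a - c2" using assms(1) by linarith+
    then show ?thesis using agree_shift[OF A, of "a - c2" "m + c2"] assms(1) by simp
  qed
  from q_position show ?thesis
  proof
    assume q: "q = k + a"
    have B: "agree x (q + b - c2) (q' - c2) (m + c2)" using before_second_run[of c2] assms by simp
    show ?thesis
    proof (rule periods_determine_next_letter)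
      show "agree x (q' - c2) (q' - c2 + a) (m + c2)"
      proof -
        have "q' - c2 + a = q' + a - c2" using q'_ge assms by simp
        then show ?thesis
          using A[OF q'(2)] agree_trans[OF agree_sym[OF B] agree_sym[OF W]] agree_trans by metis
      qed
      show "agree x (q - c2) (q - c2 + b) (m + c2)"
        using W q assms by (simp add: algebra_simps)
      show "agree x (q' - c2) (q - c2) (m + c2)"
        using W B q agree_sym agree_trans by metis
      have "x (q' + m) = x (k + m)"
        using q'(2) unfolding fork1_def agree_Suc by simp
      then show "x (q' - c2 + (m + c2)) \<noteq> x (q - c2 + (m + c2))"
        using letters q assms q'_ge by (simp add: add.assoc)
    qed (use loop in auto)
  next
    assume f: "fork1 (k + a) \<and> k + 2 * a \<le> q"
    have "k < q" using k_less_q .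
    obtain r where r: "k \<le> r" "r < q" "fork r" "r + loop r = q"
      using previous_fork[OF fork_k(4) fork_k(1) k_less_q] by auto
    have "fork1 r" using r no_fork2_before_q[of r] fork_iff by auto
    have ra: "r + a = q" using r(4) unfolding loop1[OF \<open>fork1 r\<close>] .
    show ?thesis
    proof (rule periods_determine_next_letter)
      show "agree x (k + a - c2) (k + a - c2 + a) (m + c2)"
        using A[of "k + a"] f assms by (simp add: algebra_simps)
      show uv: "agree x (k + a - c2) (q - c2) (m + c2)"
        using A[OF \<open>fork1 r\<close>] ra by simp
      show "agree x (q - c2) (q - c2 + b) (m + c2)"
        using agree_trans[OF agree_sym[OF uv] W] assms ra by (simp add: algebra_simps)
      have "x (k + a + m) = x (k + m)"
        using f unfolding fork1_def agree_Suc by simp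
      then show "x (k + a - c2 + (m + c2)) \<noteq> x (q - c2 + (m + c2))"
        using letters assms ra by (simp add: add.assoc)
    qed (use loop in auto)
  qed
qed

lemma fork_distance:
  assumes "agree x i j m" "fork (i + d)" "\<And>l. l < d \<Longrightarrow> \<not> fork (i + l)"
  shows "fork (j + d) \<and> (\<forall>l<d. \<not> fork (j + l))"
proof -
  have A: "agree x i j (m + d)" by (rule agree_until_fork[OF assms(1,3)])
  have T: "fork (i + l) \<longleftrightarrow> fork (j + l)" if "l \<le> d" for l
  proof -
    have "agree x (i + l) (j + l) m" using agree_shift[OF A, of l m] that by simp
    then show ?thesis using fork_transfer agree_sym by metis
  qed
  then show ?thesis using assms by auto
qed

text \<open>
  The blocks on the initial path, on the first loop and on the second loop are pairwise different
  except for the common final segments. Equal blocks have the same distance to the next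
  occurrence of the branching block (\<open>fork_distance\<close>), so an overlap of two of the paths is
  necessarily an overlap of their ends. The final segment that the second loop shares with the
  union of the other two paths has length at most \<open>c\<close>.
\<close>
lemma card_blocks_ge:
  assumes fin: "finite (range (block x m))"
    and c0: "c0 < a" "\<And>d. d \<le> k \<Longrightarrow> d < a \<Longrightarrow> agree x (k - d) (k + a - d) m \<Longrightarrow> d \<le> c0"
    and c: "c < b" "\<And>d. d \<le> k \<Longrightarrow> d < b \<Longrightarrow> agree x (k - d) (q + b - d) m \<Longrightarrow> d \<le> c"
      "\<And>d. d < a \<Longrightarrow> d < b \<Longrightarrow> agree x (k + a - d) (q + b - d) m \<Longrightarrow> d \<le> c"
  shows "k + a + b \<le> card (range (block x m)) + c0 + c + 1"
proof -
  have kq: "k + a \<le> q" using q_position by auto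
  \<comment> \<open>One position for each block: the initial path and the first loop up to its end segment,
  then the second loop up to its end segment. The position \<open>e i\<close> is the next fork from \<open>i\<close> on.\<close>
  define S where "S = {0..<k + a - c0} \<union> {q + 1..<q + b - c}"
  define e where "e i = (if i \<le> k then k else if i < k + a then k + a else q + b)" for i
  have e: "fork (e i) \<and> i \<le> e i \<and> (\<forall>l. i + l < e i \<longrightarrow> \<not> fork (i + l))" if "i \<in> S" for i
  proof -
    have "i \<le> k \<or> k < i \<and> i < k + a \<or> q < i \<and> i < q + b"
      using that unfolding S_def by auto
    then consider "i \<le> k" | "k < i" "i < k + a" | "q < i" "i < q + b" by blast
    then show ?thesis
    proof cases
      case 1
      then show ?thesis using no_fork_before_k fork_k unfolding e_def by auto
    next
      case 2
      then show ?thesis using no_fork_inside[of k] loop(2)[of k] unfolding e_def by auto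
    next
      case 3
      then show ?thesis using no_fork_inside[of q] loop(2)[of q] kq unfolding e_def by auto
    qed
  qed
  have ne: "\<not> agree x i j m" if ij: "i \<in> S" "j \<in> S" "i < j" for i j
  proof
    assume A: "agree x i j m"
    define d where "d = e i - i"
    have ei: "e i = i + d" using e[OF ij(1)] unfolding d_def by simp
    have D: "fork (j + d) \<and> (\<forall>l<d. \<not> fork (j + l))"
    proof (rule fork_distance[OF A])
      show "fork (i + d)" using e[OF ij(1)] ei by simp
      show "\<not> fork (i + l)" if "l < d" for l using e[OF ij(1)] ei that by simp
    qed
    have ej: "e j = j + d"
    proof (rule antisym)
      show "e j \<le> j + d" using D e[OF ij(2)] by (meson not_le)
      show "j + d \<le> e j"
      proof (rule ccontr)
        assume "\<not> j + d \<le> e j"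
        then have "e j - j < d" "j + (e j - j) = e j" using e[OF ij(2)] by auto
        then show False using D e[OF ij(2)] by metis
      qed
    qed
    have iS: "i < k + a - c0 \<or> q < i \<and> i < q + b - c" and jS: "j < k + a - c0 \<or> q < j \<and> j < q + b - c"
      using ij unfolding S_def by auto
    have "e i < e j" using ei ej ij by simp
    then consider "e i = k" "e j = k + a" "i \<le> k" "k < j" "j < k + a"
      | "e i = k" "e j = q + b" "i \<le> k" "k + a \<le> j"
      | "e i = k + a" "e j = q + b" "k < i" "i < k + a" "k + a \<le> j"
      unfolding e_def using loop(1)[of q] kq by (auto split: if_splits)
    then show False
    proof cases
      case 1
      then have "k - d = i" "k + a - d = j" "d \<le> k" "d < a" using ei ej by auto
      then show False using c0 A 1 jS kq by force
    next
      case 2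
      then have "k - d = i" "q + b - d = j" "d \<le> k" "q < j" "j < q + b - c" using ei ej jS by auto
      moreover from this have "d < b" using ej 2 by linarith
      ultimately show False using c(2)[of d] A 2 ej by auto
    next
      case 3
      then have "k + a - d = i" "q + b - d = j" "d < a" "q < j" "j < q + b - c" using ei ej jS by auto
      moreover from this have "d < b" using ej 3 by linarith
      ultimately show False using c(3)[of d] A 3 ej by auto
    qed
  qed
  have "inj_on (block x m) S"
    unfolding inj_on_def block_eq_iff using ne agree_sym by (metis linorder_neqE_nat)
  then have "card S \<le> card (range (block x m))"
    by (metis card_image card_mono fin image_mono subset_UNIV)
  moreover have "card S = (k + a - c0) + (b - c - 1)"
    unfolding S_def using kq by (subst card_Un_disjoint) auto
  ultimately show ?thesis using c0(1) c(1) by linarith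
qed

text \<open>
  The bound on repetitions applies to the initial run through first loops, to the initial path
  against the end of the first passage through the second loop, and, if \<open>q = k + a\<close>, to the run
  through second loops and to the initial path against the end of this run. The error terms
  are absorbed into \<open>m / 100\<close> and \<open>m / 1000\<close>.
\<close>
theorem complexity_at_unit_slope:
  fixes C :: real
  assumes F: "\<And>i j L. i < j \<Longrightarrow> agree x i j L \<Longrightarrow> real L \<le> 101/100 * real j + C"
    and C: "100 * C \<le> m" and m: "m \<ge> 1000" and fin: "finite (range (block x m))"
  shows "real (card (range (block x m))) \<ge> 113/100 * real m"
proof (rule ccontr)
  assume small: "\<not> ?thesis"
  have kq: "k + a \<le> q" using q_position by auto
  have pos: "0 < a" "0 < b" using loop by auto
  have "agree x k (k + a) m" "agree x k (q + b) m" "agree x (k + a) (q + b) m"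
    using loop(2) fork_k fork_agree by auto
  note * = this
  obtain c0 where c0: "c0 \<le> k \<and> c0 < a \<and> agree x (k - c0) (k + a - c0) m"
    "\<And>d. d \<le> k \<and> d < a \<and> agree x (k - d) (k + a - d) m \<Longrightarrow> d \<le> c0"
    by (rule greatest_nat[of "\<lambda>d. d \<le> k \<and> d < a \<and> agree x (k - d) (k + a - d) m" 0 k])
       (use * pos in auto)
  obtain c1 where c1: "c1 \<le> k \<and> c1 < b \<and> agree x (k - c1) (q + b - c1) m"
    "\<And>d. d \<le> k \<and> d < b \<and> agree x (k - d) (q + b - d) m \<Longrightarrow> d \<le> c1"
    by (rule greatest_nat[of "\<lambda>d. d \<le> k \<and> d < b \<and> agree x (k - d) (q + b - d) m" 0 k])
       (use * pos in auto)
  obtain c2 where c2: "c2 < a \<and> c2 < b \<and> agree x (k + a - c2) (q + b - c2) m"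
    "\<And>d. d < a \<and> d < b \<and> agree x (k + a - d) (q + b - d) m \<Longrightarrow> d \<le> c2"
    by (rule greatest_nat[of "\<lambda>d. d < a \<and> d < b \<and> agree x (k + a - d) (q + b - d) m" 0 a])
       (use * pos in auto)
  define c where "c = max c1 c2"
  have "k + a + b \<le> card (range (block x m)) + c0 + c + 1"
    by (rule card_blocks_ge[OF fin]) (use c0 c1 c2 in \<open>auto simp: c_def le_max_iff_disj\<close>)
  then have "real (k + a + b) \<le> real (card (range (block x m)) + c0 + c + 1)"
    by (rule of_nat_mono)
  then have count: "real k + real a + real b - real c0 - real c \<le> 1131/1000 * real m"
    using small m by simp
  have loops: "real a + real b \<ge> real m + real c2"
    using loops_long[of c2] c2 by simp
  have F1: "real c0 + real m + (real q - real k) - real a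
      \<le> 101/100 * (real k + real a - real c0) + 1/100 * real m"
  proof -
    have lt: "k - c0 < k + a - c0" using c0(1) pos by linarith
    show ?thesis using F[OF lt first_run[of c0]] c0(1) kq C by simp
  qed
  have "agree x (k - c1) (q + b - c1) (m + c1)" using before_k c1 by simp
  then have F4: "real c1 + real m \<le> 101/100 * (real q + real b - real c1) + 1/100 * real m"
  proof -
    have lt: "k - c1 < q + b - c1" using c1(1) kq pos by linarith
    show ?thesis using F[OF lt \<open>agree x (k - c1) (q + b - c1) (m + c1)\<close>] c1(1) C by simp
  qed
  have tails: "real c2 + real m + (real q' - real q) - real b
        \<le> 101/100 * (real q + real b - real c2) + 1/100 * real m \<and>
      real c1 + real m + real a \<le> 101/100 * (real q' - real c1) + 1/100 * real m"
    if q: "q = k + a"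
  proof
    have c2q: "c2 < b" "c2 \<le> q" "agree x (q - c2) (q + b - c2) m" using c2(1) q by auto
    have lt: "q - c2 < q + b - c2" using c2q(1) c2q(2) by linarith
    show "real c2 + real m + (real q' - real q) - real b
        \<le> 101/100 * (real q + real b - real c2) + 1/100 * real m"
      using F[OF lt second_run[OF c2q]] c2q C q'_ge by simp
    have lt: "k - c1 < q' - c1" using c1(1) kq q'_ge pos by linarith
    show "real c1 + real m + real a \<le> 101/100 * (real q' - real c1) + 1/100 * real m"
      using F[OF lt third_run[of c1]] c1(1) q'_ge C by simp
  qed
  have "real q = real k + real a \<or> real q \<ge> real k + 2 * real a"
    using q_position by auto
  then show False
    using tails q_position m c0(1) c1(1) c2(1) F1 F4 loops count[unfolded c_def of_nat_max]
    by (intro fork_inequalities_inconsistent[of m k a b c0 c1 c2 q q']) auto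
qed

end

section \<open>Complexity of words with bounded repetitions\<close>

text \<open>
  A map that loses exactly one element in the count has exactly one non-trivial fibre, of size 2.
\<close>
lemma surj_fibre_pair:
  assumes "finite S" "card S = card (f ` S) + 1"
    and w: "w1 \<in> S" "w2 \<in> S" "w1 \<noteq> w2" "f w1 = f w2"
    and u: "u \<in> S" "v \<in> S" "u \<noteq> v" "f u = f v"
  shows "u = w1 \<and> v = w2 \<or> u = w2 \<and> v = w1"
proof -
  have "f ` (S - {w1}) = f ` S" using w by (auto simp: image_iff)
  then have "inj_on f (S - {w1})"
    using assms(1,2) w by (intro eq_card_imp_inj_on) auto
  then show ?thesis using w u unfolding inj_on_def by (metis DiffI singletonD)
qed

lemma finite_blocks: "finite (range x) \<Longrightarrow> finite (range (block x n))"
  by (rule finite_subset[OF _ finite_lists_length_eq[of "range x" n]]) (auto simp: block_def)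

lemma butlast_block: "butlast (block x (Suc n) i) = block x n i"
  by (simp add: block_def)

lemma butlast_blocks: "butlast ` range (block x (Suc n)) = range (block x n)"
  by (simp add: image_image butlast_block)

text \<open>
  A word over a finite alphabet where a block of length \<open>L\<close> returns only after position
  \<open>L / 1.01 - O(1)\<close>. Such a word is not ultimately periodic. What matters about the constant
  101/100 is that it is close enough to 1 for \<open>fork_inequalities_inconsistent\<close>.
\<close>
locale bounded_repetitions =
  fixes x :: "nat \<Rightarrow> 'a" and C :: real
  assumes finite_alphabet: "finite (range x)"
    and repetition: "\<And>i j L. i < j \<Longrightarrow> agree x i j L \<Longrightarrow> real L \<le> 101/100 * real j + C"
begin

text \<open>
  If blocks of length \<open>n\<close> determined the next letter from position \<open>N\<close> on, then two equal ones,
  which exist by the pigeonhole principle, would agree forever.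
\<close>
lemma branching_beyond: "\<exists>i\<ge>N. \<exists>j\<ge>N. agree x i j n \<and> \<not> agree x i j (Suc n)"
proof (rule ccontr)
  assume "\<not> ?thesis"
  then have det: "agree x i j (Suc n)" if "i \<ge> N" "j \<ge> N" "agree x i j n" for i j
    using that by blast
  have "\<not> inj_on (block x n) {N..}"
    using finite_blocks[OF finite_alphabet, of n] infinite_Ici[of N]
    by (meson finite_imageD finite_subset image_mono subset_UNIV)
  then obtain i j where ij: "i \<ge> N" "j \<ge> N" "i < j" "agree x i j n"
    unfolding inj_on_def block_eq_iff by (metis agree_sym atLeast_iff linorder_neqE_nat)
  have all: "agree x i j (n + t)" for t
  proof (induction t)
    case (Suc t)
    have "agree x (i + t) (j + t) n" using agree_shift[OF Suc, of t n] by simp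
    then show ?case using det[of "i + t" "j + t"] ij agree_Suc_iff_shift[OF Suc] by simp
  qed (use ij in simp)
  obtain t where "real t > 101/100 * real j + C" using reals_Archimedean2 by blast
  moreover have "agree x i j t" using all[of t] by (rule agree_mono) simp
  ultimately show False using repetition[OF ij(3)] by force
qed

lemma complexity_Suc: "card (range (block x n)) < card (range (block x (Suc n)))"
proof -
  have fin: "finite (range (block x (Suc n)))" by (rule finite_blocks[OF finite_alphabet])
  obtain i j where "agree x i j n" "\<not> agree x i j (Suc n)" using branching_beyond[of 0 n] by auto
  then have "\<not> inj_on butlast (range (block x (Suc n)))"
    unfolding inj_on_def by (metis block_eq_iff butlast_block rangeI)
  then have "card (range (block x n)) \<noteq> card (range (block x (Suc n)))"
    using fin eq_card_imp_inj_on[of "range (block x (Suc n))" butlast] by (auto simp: butlast_blocks)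
  moreover have "card (range (block x n)) \<le> card (range (block x (Suc n)))"
    using card_image_le[OF fin, of butlast] by (simp add: butlast_blocks)
  ultimately show ?thesis by simp
qed

text \<open>
  Deleting the last letter maps the blocks of length \<open>m + 1\<close> onto those of length \<open>m\<close>, so
  \<open>surj_fibre_pair\<close> singles out the branching block.
\<close>
lemma fork_graph_at_unit_slope:
  assumes unit: "card (range (block x (Suc m))) = card (range (block x m)) + 1"
  obtains k q where "fork_graph x m k q"
proof -
  obtain p1 p2 where p: "agree x p1 p2 m" "\<not> agree x p1 p2 (Suc m)"
    using branching_beyond[of 0 m] by auto
  define k where "k = (LEAST i. agree x p1 i m)"
  have k: "agree x p1 k m" "\<And>i. agree x p1 i m \<Longrightarrow> k \<le> i"
    unfolding k_def by (auto intro: LeastI[of _ p1] Least_le)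
  define Q where "Q i \<longleftrightarrow> agree x k i m \<and> \<not> agree x k i (Suc m)" for i
  define q where "q = (LEAST i. Q i)"
  have "Q p1 \<or> Q p2" using k(1) p unfolding Q_def by (metis agree_sym agree_trans)
  then have q: "Q q" "\<And>i. Q i \<Longrightarrow> q \<le> i"
    unfolding q_def by (auto intro: LeastI Least_le)
  have det: "agree x k i (Suc m) \<and> agree x q j (Suc m) \<or> agree x q i (Suc m) \<and> agree x k j (Suc m)"
    if "agree x i j m" "\<not> agree x i j (Suc m)" for i j
  proof -
    have "block x (Suc m) i = block x (Suc m) k \<and> block x (Suc m) j = block x (Suc m) q \<or>
          block x (Suc m) i = block x (Suc m) q \<and> block x (Suc m) j = block x (Suc m) k"
      by (rule surj_fibre_pair[of "range (block x (Suc m))" butlast])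
         (use that q(1) unit finite_blocks[OF finite_alphabet] in
           \<open>simp_all add: butlast_blocks butlast_block block_eq_iff Q_def rangeI\<close>)
    then show ?thesis unfolding block_eq_iff using agree_sym by metis
  qed
  have "fork_graph x m k q"
  proof
    show "agree x k q m" using q by (simp add: Q_def)
    then show "x (k + m) \<noteq> x (q + m)" using q by (auto simp: Q_def agree_Suc)
    show "k \<le> i" if "agree x k i m" for i using k that agree_trans by metis
    show "q \<le> i" if "agree x q i (Suc m)" for i
    proof (rule q(2))
      show "Q i" using q(1) that unfolding Q_def by (metis agree_Suc agree_sym agree_trans)
    qed
    show "\<exists>i\<ge>N. agree x k i (Suc m)" for N
      using branching_beyond[of N m] det by blast
  qed (use det in blast)
  then show thesis by (rule that)
qed

text \<open>
  Induction on \<open>n\<close> proves \<open>p(n) \<ge> 1.13 (n - N)\<close>: where \<open>p\<close> grows by 1, the stronger estimate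
  \<open>complexity_at_unit_slope\<close> is available, and elsewhere \<open>p\<close> grows by at least 2.
\<close>
theorem complexity_lower_bound: "\<exists>N. \<forall>n\<ge>N. real (card (range (block x n))) \<ge> 9/8 * real n"
proof -
  let ?p = "\<lambda>n. real (card (range (block x n)))"
  \<comment> \<open>From \<open>N\<close> on the error terms are small enough for \<open>complexity_at_unit_slope\<close>.\<close>
  define N where "N = max 1000 (nat \<lceil>100 * C\<rceil>)"
  have N: "real N \<ge> 1000" "real N \<ge> 100 * C" unfolding N_def by linarith+
  have unit: "?p m \<ge> 113/100 * real m"
    if m: "m \<ge> N" "card (range (block x (Suc m))) = card (range (block x m)) + 1" for m
  proof -
    obtain k q where "fork_graph x m k q" using fork_graph_at_unit_slope[OF m(2)] by blast
    then interpret fork_graph x m k q .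
    have "real m \<ge> real N" using m by simp
    then show ?thesis
      using N finite_blocks[OF finite_alphabet]
      by (intro complexity_at_unit_slope[of C] repetition) auto
  qed
  have "?p n \<ge> 113/100 * real n - 113/100 * real N" if "n \<ge> N" for n
    using that
  proof (induction n rule: dec_induct)
    case (step n)
    have Sn: "113/100 * real (Suc n) = 113/100 * real n + 113/100" by simp
    show ?case
    proof (cases "card (range (block x (Suc n))) = card (range (block x n)) + 1")
      case True
      then have "?p (Suc n) = ?p n + 1" "?p n \<ge> 113/100 * real n" using unit[of n] step by simp_all
      then show ?thesis using N(1) Sn by linarith
    next
      case False
      then have "card (range (block x (Suc n))) \<ge> card (range (block x n)) + 2"
        using complexity_Suc[of n] by simp
      then have "?p (Suc n) \<ge> ?p n + 2" by linarith
      then show ?thesis using step.IH Sn by linarith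
    qed
  qed simp
  then have "?p n \<ge> 9/8 * real n" if "n \<ge> 226 * N" for n
  proof -
    have "n \<ge> N" "real n \<ge> 226 * real N" using that by linarith+
    with \<open>\<And>n. N \<le> n \<Longrightarrow> _\<close>[of n] show ?thesis by simp
  qed
  then show ?thesis by blast
qed

end

section \<open>Repetitions in the expansion of a number that is hard to approximate\<close>

text \<open>
  \<open>T n\<close> is the fractional part of \<open>b ^ n * \<xi>\<close>.
\<close>
lemma digit_tails:
  fixes b :: nat and \<xi> :: real
  assumes b: "b \<ge> 2"
  obtains T :: "nat \<Rightarrow> real" where "\<And>n. 0 \<le> T n \<and> T n < 1"
    and "\<And>n. real b * T n = real (bary_expansion b \<xi> n) + T (Suc n)"
    and "\<And>n. \<exists>z::int. real b ^ n * \<xi> = of_int z + T n"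
proof -
  define a where "a = bary_expansion b \<xi>"
  have "is_bary_expansion b \<xi> a" unfolding a_def by (rule is_bary_expansion_bary_expansion[OF b])
  then have le: "a j \<le> b - 1" and inf: "infinite {j. a j \<noteq> b - 1}"
    and eq: "\<xi> = of_int \<lfloor>\<xi>\<rfloor> + (\<Sum>j. real (a j) / real b ^ Suc j)" for j
    unfolding is_bary_expansion_def by auto
  define T where "T N = (\<Sum>j. real (a (j + N)) / real b ^ Suc j)" for N
  note B = digit_series_bounds[OF b le inf, folded T_def]
  have "\<exists>z::int. real b ^ n * \<xi> = of_int z + T n" for n
  proof (induction n)
    case 0
    have "\<xi> = of_int \<lfloor>\<xi>\<rfloor> + T 0" using eq unfolding T_def by simp
    then show ?case by auto
  next
    case (Suc n)
    then obtain z :: int where "real b ^ n * \<xi> = of_int z + T n" by blast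
    then have "real b ^ Suc n * \<xi> = of_int (int b * z + int (a n)) + T (Suc n)"
    proof -
      have "real b ^ Suc n * \<xi> = real b * (of_int z + T n)"
        using \<open>real b ^ n * \<xi> = of_int z + T n\<close> by (simp add: mult.assoc)
      then show ?thesis using B(3)[of n] by (simp add: algebra_simps)
    qed
    then show ?case by blast
  qed
  then show thesis using that[of T] B unfolding a_def by blast
qed

text \<open>
  If the digits agree on a block of length \<open>L\<close> from the positions \<open>i\<close> and \<open>j\<close> on, the fractional
  parts of \<open>b ^ i * \<xi>\<close> and \<open>b ^ j * \<xi>\<close> differ by at most \<open>b ^ -L\<close>. So \<open>q = b ^ j - b ^ i\<close> is a
  denominator not above \<open>b ^ j\<close> for which \<open>q * \<xi>\<close> is very close to an integer.
\<close>
lemma repetition_bound_from_measure: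
  fixes b :: nat and \<xi> c :: real
  assumes b: "b \<ge> 2" and c: "c > 0"
    and measure: "\<And>(q::nat) (p::int). q \<ge> 1 \<Longrightarrow> \<bar>real q * \<xi> - of_int p\<bar> \<ge> c / real q powr (101/100)"
    and ij: "i < j" and rep: "agree (bary_expansion b \<xi>) i j L"
  shows "real L \<le> 101/100 * real j + (- ln c / ln (real b))"
proof -
  obtain T where T: "\<And>n. 0 \<le> T n \<and> T n < 1"
      "\<And>n. real b * T n = real (bary_expansion b \<xi> n) + T (Suc n)"
      "\<And>n. \<exists>z::int. real b ^ n * \<xi> = of_int z + T n"
    using digit_tails[OF b] by blast
  have close: "agree (bary_expansion b \<xi>) i j L \<Longrightarrow> \<bar>T j - T i\<bar> \<le> 1 / real b ^ L" for i j L
  proof (induction L arbitrary: i j)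
    case 0
    then show ?case using T(1)[of i] T(1)[of j] by (simp add: abs_le_iff)
  next
    case (Suc L)
    have "agree (bary_expansion b \<xi>) (Suc i) (Suc j) L"
      using agree_shift[OF Suc.prems, of 1 L] by simp
    note IH = Suc.IH[OF this]
    have "bary_expansion b \<xi> i = bary_expansion b \<xi> j"
      using Suc.prems unfolding agree_def by force
    then have "real b * (T j - T i) = T (Suc j) - T (Suc i)"
      using T(2)[of i] T(2)[of j] by (simp add: algebra_simps)
    then have "T j - T i = (T (Suc j) - T (Suc i)) / real b" using b by (simp add: field_simps)
    then have "\<bar>T j - T i\<bar> = \<bar>T (Suc j) - T (Suc i)\<bar> / real b" by simp
    also have "\<dots> \<le> (1 / real b ^ L) / real b" using IH by (intro divide_right_mono) auto
    finally show ?case by (simp add: mult.commute)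
  qed
  obtain y z :: int where yz: "real b ^ i * \<xi> = of_int y + T i" "real b ^ j * \<xi> = of_int z + T j"
    using T(3) by metis
  define q where "q = b ^ j - b ^ i"
  have lt: "b ^ i < b ^ j" using ij b by simp
  then have q1: "q \<ge> 1" unfolding q_def by simp
  have q: "real q = real b ^ j - real b ^ i" unfolding q_def using lt by (simp add: of_nat_diff)
  have qb: "real q \<le> real b ^ j" unfolding q by simp
  have "real q * \<xi> - of_int (z - y) = T j - T i" unfolding q using yz by (simp add: algebra_simps)
  then have "c / real q powr (101/100) \<le> 1 / real b ^ L"
    using measure[OF q1, of "z - y"] close[OF rep] by linarith
  then have "c * real b ^ L \<le> real q powr (101/100)"
    using q1 b by (simp add: field_simps)
  also have "\<dots> \<le> (real b ^ j) powr (101/100)" using qb by (intro powr_mono2) auto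
  also have "\<dots> = real b powr (101/100 * real j)"
    using b by (simp add: powr_powr powr_realpow[symmetric] mult.commute)
  finally have "ln (c * real b ^ L) \<le> ln (real b powr (101/100 * real j))"
    using c b by (subst ln_le_cancel_iff) auto
  then have "ln c + real L * ln (real b) \<le> 101/100 * real j * ln (real b)"
    using c b by (simp add: ln_mult ln_realpow ln_powr)
  moreover have "ln (real b) > 0" using b by simp
  ultimately show ?thesis by (simp add: field_simps)
qed

lemma liminf_complexity:
  fixes b :: nat and \<xi> c \<epsilon> :: real
  assumes b: "b \<ge> 2" and \<epsilon>: "\<epsilon> > 0"
    and "\<exists>c>0. \<forall>(q::nat)\<ge>1. \<forall>p::int. \<bar>real q * \<xi> - of_int p\<bar> \<ge> c / real q powr (101/100)"
  shows "liminf (\<lambda>n. ereal (real (block_complexity n \<xi> b) / real n)) \<ge> ereal (9 / 8 - \<epsilon>)"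
proof -
  obtain c where c: "c > 0"
    and measure: "\<And>(q::nat) (p::int). q \<ge> 1 \<Longrightarrow> \<bar>real q * \<xi> - of_int p\<bar> \<ge> c / real q powr (101/100)"
    using assms(3) by blast
  have "\<forall>j. bary_expansion b \<xi> j \<in> {0..b - 1}"
    using is_bary_expansion_bary_expansion[OF b, of \<xi>] unfolding is_bary_expansion_def by (elim conjE)
  then have digits: "range (bary_expansion b \<xi>) \<subseteq> {0..b - 1}" by blast
  interpret bounded_repetitions "bary_expansion b \<xi>" "- ln c / ln (real b)"
  proof
    show "finite (range (bary_expansion b \<xi>))"
      by (rule finite_subset[OF digits finite_atLeastAtMost])
    show "real L \<le> 101/100 * real j + - ln c / ln (real b)"
      if "i < j" "agree (bary_expansion b \<xi>) i j L" for i j L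
      by (rule repetition_bound_from_measure[OF b c measure that])
  qed
  have "block_complexity n \<xi> b = card (range (block (bary_expansion b \<xi>) n))" for n
    unfolding block_complexity_def block_def by (rule arg_cong[of _ _ card]) auto
  then obtain N where N: "\<And>n. n \<ge> N \<Longrightarrow> real (block_complexity n \<xi> b) \<ge> 9/8 * real n"
    using complexity_lower_bound by auto
  have "\<forall>\<^sub>F n in sequentially. ereal (9/8 - \<epsilon>) \<le> ereal (real (block_complexity n \<xi> b) / real n)"
    using eventually_ge_at_top[of "max N 1"]
  proof eventually_elim
    case (elim n)
    then have "9/8 \<le> real (block_complexity n \<xi> b) / real n"
      using N[of n] by (simp add: le_divide_eq)
    then have "9/8 - \<epsilon> \<le> real (block_complexity n \<xi> b) / real n" using \<epsilon> by linarith
    then show ?case by simp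
  qed
  then show ?thesis by (rule Liminf_bounded)
qed

section \<open>Irrationality measures from linear forms\<close>

text \<open>
  Given \<open>q\<close>, choose \<open>n\<close> minimal with \<open>2 C q \<le> (T / K) ^ n\<close>, so that \<open>q |L n| \<le> 1/2\<close> for
  \<open>L n = Q n * \<xi> - P n\<close> and \<open>q\<close> is of the order of \<open>(T / K) ^ n\<close>. If \<open>p / q \<noteq> P n / Q n\<close>,
  the integer \<open>q P n - p Q n\<close> is at least 1 in absolute value, which
  bounds \<open>|q \<xi> - p|\<close> from below by \<open>1 / (2 |Q n|)\<close>. If \<open>p / q = P n / Q n\<close>, then \<open>|q \<xi> - p|\<close> is
  \<open>q |L n / Q n|\<close>, and the lower bound for \<open>|L n|\<close> is used. In both cases the loss against \<open>1 / q\<close> is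
  a power of \<open>K ^ n\<close>, which the condition on \<open>T\<close> turns into \<open>q powr (1/100)\<close>.
\<close>
lemma irrationality_measure_criterion:
  fixes Q P :: "nat \<Rightarrow> int" and \<xi> K T C c :: real
  assumes K: "K \<ge> 2" and T: "T \<ge> 1" "T powr (1/100) \<ge> K ^ 5" and c: "c > 0" and C: "C > 0"
    and Q: "\<And>n. \<bar>of_int (Q n)\<bar> \<le> C * (K * T) ^ n"
    and lo: "\<And>n. c / (K * T) ^ n \<le> \<bar>of_int (Q n) * \<xi> - of_int (P n)\<bar>"
    and hi: "\<And>n. \<bar>of_int (Q n) * \<xi> - of_int (P n)\<bar> \<le> C * (K / T) ^ n"
  shows "\<exists>c'>0. \<forall>(q::nat)\<ge>1. \<forall>p::int. \<bar>real q * \<xi> - of_int p\<bar> \<ge> c' / real q powr (101/100)"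
proof -
  \<comment> \<open>\<open>W = X * X / Z\<close> dominates the loss in both cases, and the condition on \<open>T\<close> gives \<open>W \<le> Z powr 1.01\<close>.\<close>
  define X Z W D where "X = K * T" and "Z = T / K" and "W = K ^ 3 * T" and "D = 1 + 2 * C * Z"
  have "T powr (1/100) \<le> T powr 1" using T by (intro powr_mono) auto
  then have "K ^ 5 \<le> T" using T by simp
  moreover have "K ^ 1 < K ^ 5" using K by (intro power_strict_increasing) auto
  ultimately have Z1: "Z > 1" unfolding Z_def using K by simp
  have D: "D > 0" unfolding D_def using C Z1 by (simp add: add_pos_pos)
  have X: "X > 0" unfolding X_def using K T by simp
  have W: "W > 0" unfolding W_def using K T by simp
  have XZW: "X * X = Z * W" unfolding X_def Z_def W_def using K by (simp add: field_simps power3_eq_cube)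
  have XW: "X \<le> W"
  proof -
    have "K * 1 \<le> K * (K * K)" using K by (intro mult_left_mono) (simp_all add: mult_ge1_I)
    then have "K * 1 * T \<le> K * (K * K) * T" using T by (intro mult_right_mono) auto
    then show ?thesis unfolding X_def W_def by (simp add: power3_eq_cube mult.assoc)
  qed
  have WZ: "W \<le> Z powr (101/100)"
  proof -
    have "K powr (101/100) \<le> K powr 2" using K by (intro powr_mono) auto
    then have k2: "K powr (101/100) \<le> K ^ 2" using K by (simp add: powr_numeral)
    have "W * K powr (101/100) \<le> W * K ^ 2" using k2 W by (intro mult_left_mono) auto
    also have "\<dots> = T * K ^ 5" unfolding W_def by (simp add: power_numeral_reduce)
    also have "\<dots> \<le> T * T powr (1/100)" using T by (intro mult_left_mono) auto
    also have "\<dots> = T powr (101/100)" using T powr_add[of T 1 "1/100"] by simp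
    finally have "W * K powr (101/100) \<le> T powr (101/100)" .
    then show ?thesis unfolding Z_def using K T by (simp add: powr_divide field_simps)
  qed
  define c' where "c' = min (1 / (2 * C)) (c / (C * D)) / D powr (101/100)"
  have "c' > 0" unfolding c'_def using C c D by simp
  moreover have "\<bar>real q * \<xi> - of_int p\<bar> \<ge> c' / real q powr (101/100)" if q: "q \<ge> 1" for q :: nat and p :: int
  proof -
    let ?ok = "\<lambda>n. 2 * C * real q \<le> Z ^ n"
    obtain n0 where "?ok n0" using real_arch_pow[OF Z1, of "2 * C * real q"] by (auto intro: less_imp_le)
    define n where "n = (LEAST n. ?ok n)"
    have n: "?ok n" unfolding n_def by (rule LeastI[of ?ok, OF \<open>?ok n0\<close>])
    have Zn: "Z ^ n \<le> D * real q"
    proof (cases n)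
      case 0
      have "1 * 1 \<le> D * real q" using q C Z1 unfolding D_def by (intro mult_mono) auto
      then show ?thesis using 0 by simp
    next
      case (Suc n')
      then have "\<not> ?ok n'" unfolding n_def by (intro not_less_Least) simp
      then have "Z * Z ^ n' \<le> Z * (2 * C * real q)" using Z1 by (intro mult_left_mono) auto
      also have "\<dots> \<le> D * real q" unfolding D_def by (simp add: algebra_simps)
      finally show ?thesis using Suc by simp
    qed
    have "W ^ n \<le> (Z powr (101/100)) ^ n" using WZ W by (intro power_mono) auto
    also have "\<dots> = (Z ^ n) powr (101/100)"
      using Z1 by (simp add: powr_realpow[symmetric] powr_powr mult.commute)
    also have "\<dots> \<le> (D * real q) powr (101/100)" using Zn Z1 by (intro powr_mono2) auto
    also have "\<dots> = D powr (101/100) * real q powr (101/100)" by (rule powr_mult)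
    finally have Wn: "W ^ n \<le> D powr (101/100) * real q powr (101/100)" .
    have target: "c' / real q powr (101/100) \<le> M / W ^ n"
      if M: "M \<ge> min (1 / (2 * C)) (c / (C * D))" for M
    proof -
      let ?m = "min (1 / (2 * C)) (c / (C * D))"
      have "?m > 0" using C c D by simp
      have "c' / real q powr (101/100) = ?m / (D powr (101/100) * real q powr (101/100))"
        unfolding c'_def by simp
      also have "\<dots> \<le> ?m / W ^ n" using Wn W D q \<open>?m > 0\<close> by (intro divide_left_mono) auto
      also have "\<dots> \<le> M / W ^ n" using M W by (intro divide_right_mono) auto
      finally show ?thesis .
    qed
    define l where "l = of_int (Q n) * \<xi> - of_int (P n)"
    have "X ^ n > 0" "W ^ n > 0" "Z ^ n > 0" using X W Z1 by simp_all
    have Qn: "\<bar>of_int (Q n)\<bar> \<le> C * X ^ n" using Q[of n] by (simp add: X_def)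
    show ?thesis
    proof (cases "int q * P n = p * Q n")
      case False
      have "real q * \<bar>l\<bar> \<le> real q * (C * (K / T) ^ n)"
        using hi[of n] unfolding l_def by (intro mult_left_mono) auto
      also have "\<dots> = C * real q / Z ^ n" unfolding Z_def using K T by (simp add: power_divide)
      also have "\<dots> \<le> 1 / 2" using n \<open>Z ^ n > 0\<close> by (simp add: field_simps)
      finally have small: "real q * \<bar>l\<bar> \<le> 1 / 2" .
      have "1 \<le> \<bar>int q * P n - p * Q n\<bar>" using False by linarith
      then have "1 \<le> \<bar>of_int (int q * P n - p * Q n) :: real\<bar>" by linarith
      also have "of_int (int q * P n - p * Q n) = of_int (Q n) * (real q * \<xi> - of_int p) - real q * l"
        unfolding l_def by (simp add: algebra_simps)
      also have "\<bar>\<dots>\<bar> \<le> \<bar>of_int (Q n)\<bar> * \<bar>real q * \<xi> - of_int p\<bar> + real q * \<bar>l\<bar>"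
        by (rule order_trans[OF abs_triangle_ineq4]) (simp add: abs_mult)
      finally have "1 / 2 \<le> \<bar>of_int (Q n)\<bar> * \<bar>real q * \<xi> - of_int p\<bar>" using small by linarith
      also have "\<dots> \<le> (C * X ^ n) * \<bar>real q * \<xi> - of_int p\<bar>"
        using Qn by (intro mult_right_mono) auto
      also have "\<dots> \<le> (C * W ^ n) * \<bar>real q * \<xi> - of_int p\<bar>"
        using XW X C by (intro mult_right_mono mult_left_mono power_mono) auto
      finally have "1 / (2 * C) / W ^ n \<le> \<bar>real q * \<xi> - of_int p\<bar>"
        using C \<open>W ^ n > 0\<close> by (simp add: field_simps)
      moreover have "c' / real q powr (101/100) \<le> 1 / (2 * C) / W ^ n" by (rule target) simp
      ultimately show ?thesis by linarith
    next
      case True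
      have "of_int (Q n) * (real q * \<xi> - of_int p) = real q * l + of_int (int q * P n - p * Q n)"
        unfolding l_def by (simp add: algebra_simps)
      then have eq: "of_int (Q n) * (real q * \<xi> - of_int p) = real q * l" using True by simp
      have "Z ^ n / D * (c / X ^ n) \<le> real q * \<bar>l\<bar>"
      proof (rule mult_mono)
        show "Z ^ n / D \<le> real q" using Zn D by (simp add: field_simps)
        show "c / X ^ n \<le> \<bar>l\<bar>" using lo[of n] by (simp add: l_def X_def)
      qed (use c X in auto)
      also have "\<dots> = \<bar>of_int (Q n) * (real q * \<xi> - of_int p)\<bar>" unfolding eq by (simp add: abs_mult)
      also have "\<dots> \<le> (C * X ^ n) * \<bar>real q * \<xi> - of_int p\<bar>"
        using Qn unfolding abs_mult by (intro mult_right_mono) auto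
      finally have "Z ^ n * c / (D * C * (X ^ n * X ^ n)) \<le> \<bar>real q * \<xi> - of_int p\<bar>"
        using C D \<open>X ^ n > 0\<close> by (simp add: field_simps)
      also have "X ^ n * X ^ n = Z ^ n * W ^ n" using XZW by (simp add: power_mult_distrib[symmetric])
      also have "Z ^ n * c / (D * C * (Z ^ n * W ^ n)) = c / (C * D) / W ^ n"
        using Z1 W C D by (simp add: field_simps)
      finally have "c / (C * D) / W ^ n \<le> \<bar>real q * \<xi> - of_int p\<bar>" .
      moreover have "c' / real q powr (101/100) \<le> c / (C * D) / W ^ n" by (rule target) simp
      ultimately show ?thesis by linarith
    qed
  qed
  ultimately show ?thesis by blast
qed

section \<open>The least common multiple of an initial segment\<close>

lemma central_binomial_le: "2 * n choose n \<le> 4 ^ n"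
proof -
  have "2 * n choose n \<le> (\<Sum>k\<le>2 * n. 2 * n choose k)"
    by (rule member_le_sum) auto
  then show ?thesis by (simp add: choose_row_sum power_mult)
qed

text \<open>
  The identity \<open>i (P choose i) = P (P - 1 choose i - 1)\<close> for \<open>P = p ^ e\<close> shows that \<open>p ^ e\<close> divides
  the left-hand side, but it cannot divide \<open>i < p ^ e\<close>.
\<close>
lemma prime_dvd_prime_power_choose:
  fixes p :: nat
  assumes "prime p" "0 < i" "i < p ^ e"
  shows "p dvd (p ^ e choose i)"
proof (rule ccontr)
  assume "\<not> ?thesis"
  then have "coprime (p ^ e) (p ^ e choose i)"
    using assms(1) prime_imp_coprime coprime_power_left_iff by blast
  moreover have "p ^ e dvd i * (p ^ e choose i)"
    using times_binomial_minus1_eq[OF assms(2), of "p ^ e"] by simp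
  ultimately have "p ^ e dvd i" by (simp add: coprime_dvd_mult_left_iff)
  then show False using assms by (auto dest: dvd_imp_le)
qed

text \<open>
  In Vandermonde's formula for \<open>2 n = P + (2 n - P)\<close> with \<open>P = p ^ e\<close> the term with index 0 vanishes
  because \<open>2 n - P < n\<close>, and \<open>p\<close> divides all others.
\<close>
lemma prime_dvd_central_binomial:
  fixes p :: nat
  assumes "prime p" "n < p ^ e" "p ^ e \<le> 2 * n"
  shows "p dvd (2 * n choose n)"
proof -
  let ?f = "\<lambda>i. (p ^ e choose i) * (2 * n - p ^ e choose (n - i))"
  have "2 * n choose n = (\<Sum>i\<le>n. ?f i)"
    using vandermonde[of "p ^ e" "2 * n - p ^ e" n] assms by simp
  moreover have "p dvd ?f i" if "i \<le> n" for i
  proof (cases "i = 0")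
    case True
    then show ?thesis using assms by (simp add: binomial_eq_0)
  next
    case False
    then show ?thesis using prime_dvd_prime_power_choose[OF assms(1), of i e] that assms by simp
  qed
  ultimately show ?thesis by (simp only:) (rule dvd_sum, simp)
qed

text \<open>
  A prime power up to \<open>2 n\<close> either is at most \<open>n\<close>, or becomes so after division by its prime \<open>p\<close>,
  and then \<open>p\<close> divides the central binomial coefficient. This gives an exponential bound for the
  least common multiple without information on the distribution of primes.
\<close>
lemma Lcm_double_dvd:
  assumes "n \<ge> 1"
  shows "Lcm {1..2 * n} dvd (2 * n choose n) * Lcm {1..n}"
proof (rule Lcm_least)
  fix j assume "j \<in> {1..2 * n}"
  then have j: "j \<ge> 1" "j \<le> 2 * n" by auto
  let ?X = "(2 * n choose n) * Lcm {1..n}"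
  have X0: "?X \<noteq> 0" by (auto simp: Lcm_0_iff)
  show "j dvd ?X"
  proof (rule multiplicity_le_imp_dvd)
    fix p :: nat assume p: "prime p"
    define e where "e = multiplicity p j"
    have "p ^ e dvd j" unfolding e_def by (rule multiplicity_dvd)
    then have le: "p ^ e \<le> 2 * n" using j by (auto dest: dvd_imp_le)
    have "p ^ e dvd ?X"
    proof (cases "p ^ e \<le> n")
      case True
      then have "p ^ e dvd Lcm {1..n}" using p by (intro dvd_Lcm) (auto simp: prime_gt_0_nat Suc_le_eq)
      then show ?thesis by simp
    next
      case False
      then obtain f where f: "e = Suc f" using assms by (cases e) auto
      have "p * p ^ f \<le> 2 * n" using le f by simp
      moreover have "2 * p ^ f \<le> p * p ^ f" using p prime_ge_2_nat by (intro mult_right_mono) auto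
      ultimately have "p ^ f \<le> n" by linarith
      then have "p ^ f dvd Lcm {1..n}" using p by (intro dvd_Lcm) (auto simp: prime_gt_0_nat Suc_le_eq)
      moreover have "p dvd (2 * n choose n)"
        using prime_dvd_central_binomial[OF p, of n e] False le by simp
      ultimately show ?thesis unfolding f by (simp add: mult_dvd_mono)
    qed
    moreover have "\<not> is_unit p" using p not_prime_unit by blast
    ultimately have "e \<le> multiplicity p ?X" using X0 multiplicity_geI by blast
    then show "multiplicity p j \<le> multiplicity p ?X" unfolding e_def .
  qed (use j in auto)
qed

lemma Lcm_power2_le: "Lcm {1..2 ^ e} \<le> (4::nat) ^ (2 ^ e)"
proof (induction e)
  case (Suc e)
  have "Lcm {1..2 * 2 ^ e} \<le> (2 * 2 ^ e choose 2 ^ e) * Lcm {1..(2::nat) ^ e}"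
    by (rule dvd_imp_le[OF Lcm_double_dvd]) (auto simp: Lcm_0_iff Suc_le_eq intro: gr0I)
  also have "\<dots> \<le> 4 ^ (2 ^ e) * 4 ^ (2 ^ e)"
    by (intro mult_le_mono central_binomial_le Suc)
  also have "\<dots> = (4::nat) ^ (2 ^ Suc e)" by (simp add: power_add[symmetric] mult_2)
  finally show ?case by simp
qed simp

lemma small_common_multiple:
  obtains d :: nat where "d \<ge> 1" "d \<le> 256 ^ n" "\<forall>j. 1 \<le> j \<longrightarrow> j \<le> 2 * n \<longrightarrow> j dvd d"
proof (cases "n = 0")
  case True
  then show thesis using that[of 1] by simp
next
  case False
  \<comment> \<open>The smallest power of 2 above \<open>2 n\<close> is at most \<open>4 n\<close>, and \<open>4 ^ (4 n) = 256 ^ n\<close>.\<close>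
  define e where "e = (LEAST e. 2 * n \<le> 2 ^ e)"
  have ex: "2 * n \<le> 2 ^ (2 * n)" using less_exp[of "2 * n"] by simp
  have e: "2 * n \<le> 2 ^ e" unfolding e_def by (rule LeastI[of "\<lambda>e. 2 * n \<le> 2 ^ e", OF ex])
  obtain f where f: "e = Suc f" using e False by (cases e) auto
  then have "\<not> 2 * n \<le> 2 ^ f" unfolding e_def by (intro not_less_Least) simp
  then have "2 ^ e \<le> 4 * n" unfolding f by simp
  then have "(4::nat) ^ (2 ^ e) \<le> 4 ^ (4 * n)" by (intro power_increasing) auto
  then have "Lcm {1..2 ^ e} \<le> (256::nat) ^ n"
    using Lcm_power2_le[of e] by (simp add: power_mult)
  moreover have "Lcm {1..(2::nat) ^ e} \<ge> 1" by (auto simp: Lcm_0_iff Suc_le_eq intro: gr0I)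
  moreover have "j dvd Lcm {1..2 ^ e}" if "1 \<le> j" "j \<le> 2 * n" for j
    using that e by (intro dvd_Lcm) auto
  ultimately show thesis using that by blast
qed

section \<open>Hypergeometric series and Jacobi polynomials\<close>

text \<open>
  The beta integral of \<open>w^(y-1) (1-w)^i\<close> over \<open>0 < w < 1\<close>.
\<close>
definition beta_moment :: "nat \<Rightarrow> real \<Rightarrow> real" where
  "beta_moment i y = fact i / pochhammer y (Suc i)"

text \<open>
  The integral of \<open>w^(y-1) / (1 - z (1-w))\<close> over \<open>0 < w < 1\<close>, which is \<open>1/y\<close> times the
  hypergeometric function with parameters 1, 1 and \<open>y + 1\<close>.
\<close>
definition beta_series :: "real \<Rightarrow> real \<Rightarrow> real" where
  "beta_series z y = (\<Sum>i. beta_moment i y * z ^ i)"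

lemma beta_moment_0 [simp]: "beta_moment 0 y = 1 / y"
  by (simp add: beta_moment_def)

lemma beta_moment_pos: "y > 0 \<Longrightarrow> beta_moment i y > 0"
  by (simp add: beta_moment_def pochhammer_pos)

lemma beta_moment_Suc_left:
  assumes "y > 0"
  shows "beta_moment (Suc i) y * (y + real i + 1) = (real i + 1) * beta_moment i y"
proof -
  have "y + real i + 1 > 0" using assms by simp
  moreover have "beta_moment (Suc i) y
      = (real i + 1) * fact i / (pochhammer y (Suc i) * (y + real i + 1))"
    unfolding beta_moment_def pochhammer_Suc[of y "Suc i"] by (simp add: add.assoc add.commute)
  ultimately show ?thesis by (simp add: beta_moment_def)
qed

lemma beta_moment_Suc_right:
  assumes "y > 0"
  shows "beta_moment i (y + 1) = beta_moment i y - beta_moment (Suc i) y"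
proof -
  have p: "pochhammer y (Suc i) > 0" "pochhammer (y + 1) (Suc i) > 0"
    using assms by (simp_all add: pochhammer_pos)
  have "y * pochhammer (y + 1) (Suc i) = pochhammer y (Suc i) * (y + real i + 1)"
    using pochhammer_rec[of y "Suc i"] pochhammer_Suc[of y "Suc i"] by (simp add: algebra_simps)
  then have "beta_moment i (y + 1) = y * beta_moment i y / (y + real i + 1)"
    using assms p unfolding beta_moment_def by (simp add: divide_simps mult.commute)
  moreover have "beta_moment (Suc i) y = (real i + 1) * beta_moment i y / (y + real i + 1)"
    using beta_moment_Suc_left[OF assms, of i] assms by (simp add: eq_divide_eq)
  moreover have "y * B / (y + real i + 1) + (real i + 1) * B / (y + real i + 1) = B" for B
  proof -
    have "y * B + (real i + 1) * B = (y + real i + 1) * B" by (simp add: algebra_simps)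
    then show ?thesis using assms by (simp add: add_divide_distrib[symmetric])
  qed
  ultimately have "beta_moment i (y + 1) + beta_moment (Suc i) y = beta_moment i y" by simp
  then show ?thesis by simp
qed

lemma beta_moment_le: 
  assumes "y > 0"
  shows "beta_moment i y \<le> 1 / y"
proof (induction i)
  case (Suc i)
  have "beta_moment (Suc i) y < beta_moment i y"
    using beta_moment_Suc_right[OF assms, of i] beta_moment_pos[of "y + 1" i] assms by simp
  then show ?case using Suc by simp
qed simp

lemma beta_series_sums:
  assumes "y > 0" "0 \<le> z" "z < 1"
  shows "(\<lambda>i. beta_moment i y * z ^ i) sums beta_series z y"
  unfolding beta_series_def
proof (rule summable_sums, rule summable_comparison_test')
  show "summable (\<lambda>i. 1 / y * z ^ i)" using assms by (intro summable_mult summable_geometric) auto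
  show "norm (beta_moment i y * z ^ i) \<le> 1 / y * z ^ i" if "i \<ge> 0" for i
    using mult_right_mono[OF beta_moment_le[OF assms(1), of i], of "z ^ i"]
      beta_moment_pos[OF assms(1), of i] assms by (simp add: abs_mult)
qed

text \<open>
  Multiplying the kernel \<open>1 / (1 - z (1-w))\<close> by \<open>w = (1 - 1/z) + (1 - z (1-w)) / z\<close> produces
  \<open>1 - 1/z\<close> times the kernel plus the constant \<open>1/z\<close>.
\<close>
lemma beta_series_shift:
  assumes "y > 0" "0 < z" "z < 1"
  shows "beta_series z (y + 1) = (1 - 1 / z) * beta_series z y + 1 / (z * y)"
proof -
  have S: "(\<lambda>i. beta_moment i y * z ^ i) sums beta_series z y"
    using beta_series_sums assms by simp
  then have "(\<lambda>i. beta_moment (Suc i) y * z ^ Suc i) sums (beta_series z y - 1 / y)"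
    by (subst sums_Suc_iff) simp
  then have "(\<lambda>i. beta_moment (Suc i) y * z ^ Suc i / z) sums ((beta_series z y - 1 / y) / z)"
    by (rule sums_divide)
  then have "(\<lambda>i. beta_moment (Suc i) y * z ^ i) sums ((beta_series z y - 1 / y) / z)"
    using assms by simp
  from sums_diff[OF S this]
  have "(\<lambda>i. beta_moment i (y + 1) * z ^ i) sums (beta_series z y - (beta_series z y - 1 / y) / z)"
    by (simp only: beta_moment_Suc_right[OF assms(1)] left_diff_distrib)
  moreover have "(\<lambda>i. beta_moment i (y + 1) * z ^ i) sums beta_series z (y + 1)"
    using beta_series_sums assms by simp
  ultimately have "beta_series z (y + 1) = beta_series z y - (beta_series z y - 1 / y) / z"
    by (rule sums_unique2[symmetric])
  then show ?thesis using assms by (simp add: field_simps)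
qed

lemma beta_series_shift_nat:
  assumes "y > 0" "0 < z" "z < 1"
  shows "beta_series z (y + real k) = (1 - 1 / z) ^ k * beta_series z y
    + (\<Sum>j<k. (1 - 1 / z) ^ (k - 1 - j) / (y + real j)) / z"
proof (induction k)
  case (Suc k)
  let ?w = "1 - 1 / z"
  have "(\<Sum>j<Suc k. ?w ^ (Suc k - 1 - j) / (y + real j))
      = (\<Sum>j<k. ?w * (?w ^ (k - 1 - j) / (y + real j))) + 1 / (y + real k)"
  proof -
    have "?w ^ (k - j) / (y + real j) = ?w * (?w ^ (k - 1 - j) / (y + real j))" if "j < k" for j
    proof -
      have "k - j = Suc (k - 1 - j)" using that by simp
      then show ?thesis by (simp only: power_Suc times_divide_eq_right)
    qed
    then have "(\<Sum>j<k. ?w ^ (k - j) / (y + real j)) = (\<Sum>j<k. ?w * (?w ^ (k - 1 - j) / (y + real j)))"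
      by (intro sum.cong) auto
    then show ?thesis by simp
  qed
  then have "(\<Sum>j<Suc k. ?w ^ (Suc k - 1 - j) / (y + real j))
      = ?w * (\<Sum>j<k. ?w ^ (k - 1 - j) / (y + real j)) + 1 / (y + real k)"
    by (simp only: sum_distrib_left)
  moreover have "beta_series z (y + real (Suc k)) = ?w * beta_series z (y + real k) + 1 / (z * (y + real k))"
    using beta_series_shift[of "y + real k" z] assms by (simp add: algebra_simps)
  moreover have "(?w * S + 1 / (y + real k)) / z = ?w * (S / z) + 1 / (z * (y + real k))" for S
    by (simp add: add_divide_distrib mult.commute)
  ultimately show ?case unfolding Suc by (simp only: power_Suc distrib_left mult.assoc add.assoc)
qed simp

text \<open>
  The \<open>n\<close>-th finite difference of \<open>g\<close> at 0, up to sign.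
\<close>
definition alternating_sum :: "nat \<Rightarrow> (nat \<Rightarrow> real) \<Rightarrow> real" where
  "alternating_sum n g = (\<Sum>k\<le>n. (-1) ^ k * real (n choose k) * g k)"

lemma alternating_sum_0 [simp]: "alternating_sum 0 g = g 0"
  by (simp add: alternating_sum_def)

lemma alternating_sum_Suc: "alternating_sum (Suc n) g = alternating_sum n (\<lambda>k. g k - g (Suc k))"
proof -
  have "alternating_sum (Suc n) g = g 0 + (\<Sum>k\<le>n. (-1) ^ Suc k * real (Suc n choose Suc k) * g (Suc k))"
    unfolding alternating_sum_def by (subst sum.atMost_Suc_shift) simp
  also have "(\<Sum>k\<le>n. (-1) ^ Suc k * real (Suc n choose Suc k) * g (Suc k))
     = (\<Sum>k\<le>n. (-1) ^ Suc k * real (n choose Suc k) * g (Suc k))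
       - (\<Sum>k\<le>n. (-1) ^ k * real (n choose k) * g (Suc k))"
    by (subst sum_subtractf[symmetric], rule sum.cong) (simp_all add: algebra_simps)
  also have "g 0 + ((\<Sum>k\<le>n. (-1) ^ Suc k * real (n choose Suc k) * g (Suc k)) - S)
     = (\<Sum>k\<le>Suc n. (-1) ^ k * real (n choose k) * g k) - S" for S
    by (subst sum.atMost_Suc_shift) simp
  also have "(\<Sum>k\<le>Suc n. (-1) ^ k * real (n choose k) * g k) = alternating_sum n g"
    unfolding alternating_sum_def by simp
  finally show ?thesis
    unfolding alternating_sum_def by (simp add: sum_subtractf algebra_simps)
qed

lemma alternating_sum_cmult: "alternating_sum n (\<lambda>k. c * g k) = c * alternating_sum n g"
  unfolding alternating_sum_def by (simp add: sum_distrib_left mult.left_commute)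

lemma alternating_sum_pochhammer:
  "r < n \<Longrightarrow> alternating_sum n (\<lambda>k. pochhammer (y + real k) r) = 0"
proof (induction n arbitrary: r y)
  case (Suc n)
  show ?case
  proof (cases r)
    case 0
    then show ?thesis unfolding alternating_sum_Suc by (simp add: alternating_sum_def)
  next
    case (Suc r')
    have "pochhammer (y + real k) r - pochhammer (y + real (Suc k)) r
        = - real r * pochhammer (y + 1 + real k) r'" for k
    proof -
      have "pochhammer (y + real k) r = (y + real k) * pochhammer (y + 1 + real k) r'"
        unfolding Suc pochhammer_rec by (simp add: algebra_simps)
      moreover have "pochhammer (y + real (Suc k)) r
          = pochhammer (y + 1 + real k) r' * (y + 1 + real k + real r')"
        unfolding Suc pochhammer_Suc by (simp add: algebra_simps)
      ultimately show ?thesis unfolding Suc by (simp add: algebra_simps)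
    qed
    then have "alternating_sum (Suc n) (\<lambda>k. pochhammer (y + real k) r)
        = - real r * alternating_sum n (\<lambda>k. pochhammer (y + 1 + real k) r')"
      unfolding alternating_sum_Suc alternating_sum_cmult[symmetric] by simp
    then show ?thesis using Suc.IH[of r' "y + 1"] Suc.prems Suc by simp
  qed
qed simp

lemma alternating_sum_inverse_pochhammer:
  assumes "y > 0"
  shows "alternating_sum n (\<lambda>k. 1 / pochhammer (y + real k) r) = pochhammer (real r) n / pochhammer y (r + n)"
  using assms
proof (induction n arbitrary: r y)
  case (Suc n)
  have "1 / pochhammer (y + real k) r - 1 / pochhammer (y + real (Suc k)) r
      = real r * (1 / pochhammer (y + real k) (Suc r))" for k
  proof -
    let ?Y = "y + real k"
    have Y: "?Y > 0" using Suc.prems by simp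
    have P: "pochhammer ?Y r > 0" "pochhammer (?Y + 1) r > 0" using Y by (simp_all add: pochhammer_pos)
    have e1: "pochhammer ?Y (Suc r) = pochhammer ?Y r * (?Y + real r)" by (rule pochhammer_Suc)
    have e2: "pochhammer ?Y (Suc r) = ?Y * pochhammer (?Y + 1) r" by (rule pochhammer_rec)
    have "1 / pochhammer ?Y r = (?Y + real r) / pochhammer ?Y (Suc r)" unfolding e1 using Y P by simp
    moreover have "1 / pochhammer (?Y + 1) r = ?Y / pochhammer ?Y (Suc r)" unfolding e2 using Y P by simp
    moreover have "y + real (Suc k) = ?Y + 1" by simp
    ultimately show ?thesis by (simp only: diff_divide_distrib[symmetric]) simp
  qed
  then have "alternating_sum (Suc n) (\<lambda>k. 1 / pochhammer (y + real k) r)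
      = real r * alternating_sum n (\<lambda>k. 1 / pochhammer (y + real k) (Suc r))"
    unfolding alternating_sum_Suc alternating_sum_cmult[symmetric] by simp
  also have "\<dots> = real r * (pochhammer (real (Suc r)) n / pochhammer y (Suc r + n))"
    using Suc.IH[OF Suc.prems] by simp
  also have "\<dots> = pochhammer (real r) (Suc n) / pochhammer y (r + Suc n)"
    by (simp add: pochhammer_rec add.commute)
  finally show ?case .
qed simp

text \<open>
  The coefficients of the Jacobi polynomial that is orthogonal to the polynomials of smaller degree
  on \<open>0 < w < 1\<close> for the weight \<open>w^(\<alpha>-1)\<close>; for \<open>\<alpha> = 1\<close> it is the shifted Legendre polynomial.
\<close>
definition jacobi_coeff :: "real \<Rightarrow> nat \<Rightarrow> nat \<Rightarrow> real" where
  "jacobi_coeff \<alpha> n k = (-1) ^ k * real (n choose k) * (pochhammer (\<alpha> + real k) n / fact n)"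

text \<open>
  The integral of the Jacobi polynomial against \<open>w^(\<alpha>-1) (1-w)^i\<close>. As the sum over \<open>k\<close> is a finite
  difference of a quotient of two rising factorials, it vanishes for \<open>i < n\<close>, where this quotient is a
  polynomial of degree less than \<open>n\<close>, and it is explicit and positive for \<open>i \<ge> n\<close>, where it is the
  reciprocal of a rising factorial.
\<close>
definition jacobi_moment :: "real \<Rightarrow> nat \<Rightarrow> nat \<Rightarrow> real" where
  "jacobi_moment \<alpha> n i = (\<Sum>k\<le>n. jacobi_coeff \<alpha> n k * beta_moment i (\<alpha> + real k))"

lemma jacobi_moment_alt:
  "jacobi_moment \<alpha> n i = fact i / fact n * alternating_sum n
     (\<lambda>k. pochhammer (\<alpha> + real k) n / pochhammer (\<alpha> + real k) (Suc i))"
  unfolding jacobi_moment_def jacobi_coeff_def beta_moment_def alternating_sum_def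
  by (simp add: sum_distrib_left mult_ac)

lemma jacobi_moment_eq_0:
  assumes "\<alpha> > 0" "i < n"
  shows "jacobi_moment \<alpha> n i = 0"
proof -
  have "pochhammer (\<alpha> + real k) n / pochhammer (\<alpha> + real k) (Suc i)
      = pochhammer (\<alpha> + real (Suc i) + real k) (n - Suc i)" for k
  proof -
    have "pochhammer (\<alpha> + real k) (Suc i) > 0" using assms by (intro pochhammer_pos) simp
    then show ?thesis
      using pochhammer_product[of "Suc i" n "\<alpha> + real k"] assms by (simp add: ac_simps)
  qed
  then show ?thesis
    unfolding jacobi_moment_alt using alternating_sum_pochhammer[of "n - Suc i" n] assms by simp
qed

lemma jacobi_moment_eq:
  assumes "\<alpha> > 0" "i \<ge> n"
  shows "jacobi_moment \<alpha> n i
    = fact i / fact n * (pochhammer (real (Suc i - n)) n / pochhammer (\<alpha> + real n) (Suc i))"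
proof -
  have "pochhammer (\<alpha> + real k) n / pochhammer (\<alpha> + real k) (Suc i)
      = 1 / pochhammer (\<alpha> + real n + real k) (Suc i - n)" for k
  proof -
    have "pochhammer (\<alpha> + real k) n > 0" using assms by (intro pochhammer_pos) simp
    then show ?thesis
      using pochhammer_product[of n "Suc i" "\<alpha> + real k"] assms by (simp add: ac_simps)
  qed
  then show ?thesis
    unfolding jacobi_moment_alt
    using alternating_sum_inverse_pochhammer[of "\<alpha> + real n" n "Suc i - n"] assms by simp
qed

lemma jacobi_coeff_sum_le:
  assumes "0 < \<alpha>" "\<alpha> \<le> 1"
  shows "(\<Sum>k\<le>n. \<bar>jacobi_coeff \<alpha> n k\<bar>) \<le> 8 ^ n"
proof -
  have le: "\<bar>jacobi_coeff \<alpha> n k\<bar> \<le> real (n choose k) * 4 ^ n" if "k \<le> n" for k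
  proof -
    have "pochhammer (\<alpha> + real k) n \<le> pochhammer (1 + real k) n"
      unfolding pochhammer_prod using assms by (intro prod_mono) auto
    also have "\<dots> = fact (k + n) / fact k"
      using pochhammer_product'[of "1::real" k n] by (simp add: pochhammer_fact[symmetric])
    finally have "pochhammer (\<alpha> + real k) n / fact n \<le> fact (k + n) / fact k / fact n"
      by (intro divide_right_mono) auto
    also have "\<dots> = real ((k + n) choose k)" by (simp add: binomial_fact)
    also have "\<dots> \<le> real (\<Sum>j\<le>k + n. (k + n) choose j)"
      by (intro of_nat_mono member_le_sum) auto
    also have "\<dots> = 2 ^ (k + n)" by (simp add: choose_row_sum)
    also have "\<dots> \<le> 2 ^ (2 * n)" using that by (intro power_increasing) auto
    finally have "pochhammer (\<alpha> + real k) n / fact n \<le> 4 ^ n" by (simp add: power_mult)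
    moreover have "pochhammer (\<alpha> + real k) n \<ge> 0" using assms by (intro pochhammer_nonneg) simp
    ultimately show ?thesis
      using mult_left_mono[of "pochhammer (\<alpha> + real k) n / fact n" "4 ^ n" "real (n choose k)"]
      unfolding jacobi_coeff_def by (simp add: abs_mult)
  qed
  have "(\<Sum>k\<le>n. \<bar>jacobi_coeff \<alpha> n k\<bar>) \<le> (\<Sum>k\<le>n. real (n choose k) * 4 ^ n)"
    using le by (intro sum_mono) simp
  also have "\<dots> = real (\<Sum>k\<le>n. n choose k) * 4 ^ n" by (simp add: sum_distrib_right)
  also have "\<dots> = 8 ^ n" by (simp add: choose_row_sum power_mult_distrib[symmetric])
  finally show ?thesis .
qed

lemma jacobi_moment_le:
  assumes "0 < \<alpha>" "\<alpha> \<le> 1"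
  shows "jacobi_moment \<alpha> n i \<le> 8 ^ n / \<alpha>"
proof -
  have "jacobi_moment \<alpha> n i \<le> (\<Sum>k\<le>n. \<bar>jacobi_coeff \<alpha> n k\<bar> * (1 / \<alpha>))"
    unfolding jacobi_moment_def
  proof (rule sum_mono)
    fix k
    have "beta_moment i (\<alpha> + real k) \<le> 1 / (\<alpha> + real k)" using assms by (intro beta_moment_le) simp
    also have "\<dots> \<le> 1 / \<alpha>" using assms by (intro divide_left_mono) (auto intro: mult_pos_pos add_pos_nonneg)
    finally have b: "beta_moment i (\<alpha> + real k) \<le> 1 / \<alpha>" .
    have "beta_moment i (\<alpha> + real k) \<ge> 0" using beta_moment_pos[of "\<alpha> + real k" i] assms by simp
    then have "jacobi_coeff \<alpha> n k * beta_moment i (\<alpha> + real k)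
        \<le> \<bar>jacobi_coeff \<alpha> n k\<bar> * beta_moment i (\<alpha> + real k)" by (intro mult_right_mono) auto
    also have "\<dots> \<le> \<bar>jacobi_coeff \<alpha> n k\<bar> * (1 / \<alpha>)" using b by (intro mult_left_mono) auto
    finally show "jacobi_coeff \<alpha> n k * beta_moment i (\<alpha> + real k) \<le> \<bar>jacobi_coeff \<alpha> n k\<bar> * (1 / \<alpha>)" .
  qed
  also have "\<dots> = (\<Sum>k\<le>n. \<bar>jacobi_coeff \<alpha> n k\<bar>) / \<alpha>" by (simp add: sum_divide_distrib)
  also have "\<dots> \<le> 8 ^ n / \<alpha>" using jacobi_coeff_sum_le[OF assms, of n] assms by (intro divide_right_mono) auto
  finally show ?thesis .
qed

lemma jacobi_moment_nonneg: "\<alpha> > 0 \<Longrightarrow> jacobi_moment \<alpha> n i \<ge> 0"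
  using jacobi_moment_eq_0[of \<alpha> i n] jacobi_moment_eq[of \<alpha> n i]
  by (cases "i < n") (auto intro!: divide_nonneg_nonneg mult_nonneg_nonneg pochhammer_nonneg)

lemma jacobi_moment_diag_ge:
  assumes "0 < \<alpha>" "\<alpha> \<le> 1"
  shows "jacobi_moment \<alpha> n n \<ge> 1 / 12 ^ n"
proof -
  have "pochhammer (\<alpha> + real n) (Suc n) \<le> pochhammer (1 + real n) (Suc n)"
    unfolding pochhammer_prod using assms by (intro prod_mono) auto
  also have "\<dots> = real (2 * n + 1) * real (2 * n choose n) * fact n"
  proof -
    have "fact n * pochhammer (1 + real n) (Suc n) = fact (Suc (2 * n))"
      using pochhammer_product'[of "1::real" n "Suc n", folded pochhammer_fact] by (simp only: add_Suc_right mult_2)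
    also have "\<dots> = real (2 * n + 1) * fact (2 * n)" by simp
    also have "fact (2 * n) = real (2 * n choose n) * fact n * fact n"
      using binomial_fact[of n "2 * n", where 'a = real] by simp
    finally show ?thesis by simp
  qed
  also have "\<dots> \<le> 3 ^ n * 4 ^ n * fact n"
  proof (intro mult_mono)
    show "real (2 * n + 1) \<le> 3 ^ n"
    proof (induction n)
      case (Suc n)
      have "(1::real) \<le> 3 ^ n" by simp
      then show ?case using Suc by simp
    qed simp
    show "real (2 * n choose n) \<le> 4 ^ n"
      using of_nat_mono[OF central_binomial_le[of n], where 'a = real] by simp
  qed auto
  finally have "pochhammer (\<alpha> + real n) (Suc n) \<le> 12 ^ n * fact n"
    by (simp add: power_mult_distrib[symmetric])
  moreover have p: "pochhammer (\<alpha> + real n) (Suc n) > 0" using assms by (intro pochhammer_pos) simp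
  ultimately have "1 / 12 ^ n \<le> fact n / pochhammer (\<alpha> + real n) (Suc n)"
    by (simp add: divide_le_eq le_divide_eq mult.commute del: pochhammer_Suc)
  also have "\<dots> = jacobi_moment \<alpha> n n"
    using jacobi_moment_eq[of \<alpha> n n] assms pochhammer_fact[of n, where 'a = real] by (simp del: pochhammer_Suc)
  finally show ?thesis .
qed

text \<open>
  The linear form is the power series of the Jacobi moments. All its terms are non-negative, so
  the term \<open>i = n\<close> alone is a lower bound.
\<close>
lemma jacobi_remainder:
  fixes n :: nat
  assumes \<alpha>: "0 < \<alpha>" "\<alpha> \<le> 1" and z: "0 < z" "z < 1"
  defines "l \<equiv> \<Sum>k\<le>n. jacobi_coeff \<alpha> n k * beta_series z (\<alpha> + real k)"
  shows "(z / 12) ^ n \<le> l" "l \<le> (8 * z) ^ n / (\<alpha> * (1 - z))"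
proof -
  have "(\<lambda>i. \<Sum>k\<le>n. jacobi_coeff \<alpha> n k * (beta_moment i (\<alpha> + real k) * z ^ i)) sums l"
    unfolding l_def using \<alpha> z by (intro sums_sum sums_mult beta_series_sums) auto
  then have S: "(\<lambda>i. jacobi_moment \<alpha> n i * z ^ i) sums l"
    unfolding jacobi_moment_def by (simp add: sum_distrib_right mult.assoc)
  have "jacobi_moment \<alpha> n n * z ^ n = (\<Sum>i\<in>{n}. jacobi_moment \<alpha> n i * z ^ i)" by simp
  also have "\<dots> \<le> l"
    unfolding sums_unique[OF S]
    using \<alpha> z jacobi_moment_nonneg by (intro sum_le_suminf sums_summable[OF S]) auto
  finally have "jacobi_moment \<alpha> n n * z ^ n \<le> l" .
  moreover have "1 / 12 ^ n * z ^ n \<le> jacobi_moment \<alpha> n n * z ^ n"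
    using jacobi_moment_diag_ge[OF \<alpha>] z by (intro mult_right_mono) auto
  ultimately show "(z / 12) ^ n \<le> l" by (simp add: power_divide)
  have "(\<lambda>i. jacobi_moment \<alpha> n (i + n) * z ^ (i + n)) sums l"
    using sums_iff_shift[of "\<lambda>i. jacobi_moment \<alpha> n i * z ^ i" n l] S jacobi_moment_eq_0[OF \<alpha>(1)] by simp
  moreover have "(\<lambda>i. 8 ^ n / \<alpha> * z ^ n * z ^ i) sums (8 ^ n / \<alpha> * z ^ n * (1 / (1 - z)))"
    using z by (intro sums_mult geometric_sums) auto
  ultimately have "l \<le> 8 ^ n / \<alpha> * z ^ n * (1 / (1 - z))"
  proof (rule sums_le[rotated])
    fix i
    have "jacobi_moment \<alpha> n (i + n) * z ^ (i + n) \<le> 8 ^ n / \<alpha> * z ^ (i + n)"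
      using jacobi_moment_le[OF \<alpha>] z by (intro mult_right_mono) auto
    then show "jacobi_moment \<alpha> n (i + n) * z ^ (i + n) \<le> 8 ^ n / \<alpha> * z ^ n * z ^ i"
      by (simp add: power_add mult_ac)
  qed
  then show "l \<le> (8 * z) ^ n / (\<alpha> * (1 - z))" by (simp add: power_mult_distrib)
qed

text \<open>
  For \<open>k = 0\<close> this is \<open>4 ^ n\<close> if \<open>\<alpha> = 1\<close>, and the central binomial coefficient if \<open>\<alpha> = 1/2\<close>. Pascal's
  rule for the quotients carries integrality over to larger \<open>k\<close>.
\<close>
lemma pochhammer_quotient_integral:
  assumes "\<alpha> = 1 \<or> \<alpha> = 1/2"
  shows "4 ^ n * (pochhammer (\<alpha> + real k) n / fact n) \<in> \<int>"
proof (induction k arbitrary: n)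
  case 0
  show ?case
  proof (cases "\<alpha> = 1")
    case True
    then show ?thesis by (simp add: pochhammer_fact[symmetric])
  next
    case False
    then have "\<alpha> = 1/2" using assms by simp
    then have "4 ^ n * (pochhammer (\<alpha> + real 0) n / fact n) = real (2 * n choose n)"
    proof -
      have "real (2 * n choose n) = fact (2 * n) / (fact n * fact n)"
        using binomial_fact[of n "2 * n", where 'a = real] by simp
      also have "\<dots> = 2 ^ (2 * n) * (pochhammer (1/2) n / fact n)" by (simp add: fact_double)
      finally show ?thesis unfolding \<open>\<alpha> = 1/2\<close> by (simp add: power_mult)
    qed
    then show ?thesis by simp
  qed
next
  case (Suc k)
  note IH = Suc.IH
  show ?case
  proof (induction n)
    case (Suc n)
    let ?y = "\<alpha> + real k"
    have "pochhammer (?y + 1) (Suc n) = pochhammer ?y (Suc n) + (real n + 1) * pochhammer (?y + 1) n"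
      unfolding pochhammer_rec[of ?y n] pochhammer_Suc[of "?y + 1" n] by (simp add: algebra_simps)
    then have "4 ^ Suc n * (pochhammer (?y + 1) (Suc n) / fact (Suc n))
        = 4 ^ Suc n * (pochhammer ?y (Suc n) / fact (Suc n))
          + 4 * (4 ^ n * (pochhammer (?y + 1) n / fact n))"
    proof -
      have "(real n + 1) * Y / fact (Suc n) = Y / fact n" for Y :: real
        unfolding fact_Suc by (simp add: add.commute)
      then show ?thesis
        using \<open>pochhammer (?y + 1) (Suc n) = _\<close>
        by (simp only: add_divide_distrib distrib_left power_Suc mult.assoc)
    qed
    moreover have y: "?y + 1 = \<alpha> + real (Suc k)" by simp
    moreover have "4 * (4 ^ n * (pochhammer (?y + 1) n / fact n)) \<in> \<int>"
      using Suc unfolding y by (rule Ints_mult[OF Ints_numeral])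
    ultimately show ?case using IH[of "Suc n"] unfolding y by (simp only: Ints_add)
  qed simp
qed

section \<open>Irrationality measure of the hypergeometric series\<close>

text \<open>
  By \<open>beta_series_shift_nat\<close> the form \<open>\<Sum>k\<le>n. jacobi_coeff \<alpha> n k * beta_series z (\<alpha> + real k)\<close> is a
  linear combination of 1 and \<open>beta_series z \<alpha>\<close>. Its denominators come from the Jacobi coefficients,
  from the powers of \<open>1 - 1 / z = - (N - B) / B\<close>, and from \<open>1 / (\<alpha> + j)\<close> with \<open>j < n\<close>; they are cleared by
  \<open>4 ^ n\<close>, \<open>B ^ n\<close> and a common multiple of \<open>1, ..., 2 n\<close>.
\<close>
lemma beta_series_approximation:
  fixes \<alpha> :: real and B N n :: nat
  assumes \<alpha>: "\<alpha> = 1 \<or> \<alpha> = 1/2" and BN: "0 < B" "B < N"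
  defines "z \<equiv> real B / real N"
  obtains Q P :: int and D :: real where "1 \<le> D" "D \<le> 256 ^ n"
    "\<bar>of_int Q\<bar> \<le> (8192 * real N) ^ n"
    "of_int Q * (z * beta_series z \<alpha>) + of_int P
       = z * (4 * real B) ^ n * D * (\<Sum>k\<le>n. jacobi_coeff \<alpha> n k * beta_series z (\<alpha> + real k))"
proof -
  have \<alpha>1: "0 < \<alpha>" "\<alpha> \<le> 1" using \<alpha> by auto
  have z: "0 < z" "z < 1" unfolding z_def using BN by auto
  define w where "w = 1 - 1 / z"
  obtain d :: nat where d: "d \<ge> 1" "d \<le> 256 ^ n" "\<forall>j. 1 \<le> j \<longrightarrow> j \<le> 2 * n \<longrightarrow> j dvd d"
    by (rule small_common_multiple[of n])
  have w_int: "real B ^ m * w ^ i \<in> \<int>" if "i \<le> m" for i m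
  proof -
    have "real B * w = real B - real N" unfolding w_def z_def using BN by (simp add: field_simps)
    then have "real B * w \<in> \<int>" by simp
    moreover have "real B ^ m * w ^ i = real B ^ (m - i) * (real B * w) ^ i"
      using that by (simp add: power_mult_distrib power_add[symmetric] mult.assoc[symmetric])
    ultimately show ?thesis by simp
  qed
  have coeff_int: "4 ^ n * jacobi_coeff \<alpha> n k \<in> \<int>" for k
  proof -
    have "4 ^ n * jacobi_coeff \<alpha> n k
        = (-1) ^ k * real (n choose k) * (4 ^ n * (pochhammer (\<alpha> + real k) n / fact n))"
      unfolding jacobi_coeff_def by simp
    also have "\<dots> \<in> \<int>" by (rule Ints_mult[OF _ pochhammer_quotient_integral[OF \<alpha>]]) simp
    finally show ?thesis .
  qed
  have denom_int: "real d / (\<alpha> + real j) \<in> \<int>" if "j < n" for j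
    using \<alpha>
  proof
    assume "\<alpha> = 1"
    have "Suc j dvd d" using that d(3) by simp
    then obtain e where "d = Suc j * e" by (auto simp: dvd_def)
    then have "real d / (\<alpha> + real j) = real e" unfolding \<open>\<alpha> = 1\<close> by (simp add: field_simps)
    then show ?thesis by simp
  next
    assume "\<alpha> = 1/2"
    have "2 * j + 1 dvd d" using that d(3) by simp
    then obtain e where "d = (2 * j + 1) * e" by (auto simp: dvd_def)
    then have "real d / (\<alpha> + real j) = real (2 * e)" unfolding \<open>\<alpha> = 1/2\<close> by (simp add: field_simps)
    then show ?thesis by simp
  qed
  define s where "s = (4 * real B) ^ n * real d"
  define q where "q = (\<Sum>k\<le>n. s * (jacobi_coeff \<alpha> n k * w ^ k))"
  define p where "p = (\<Sum>k\<le>n. \<Sum>j<k. s * (jacobi_coeff \<alpha> n k * (w ^ (k - 1 - j) / (\<alpha> + real j))))"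
  have "q \<in> \<int>" unfolding q_def
  proof (rule Ints_sum)
    fix k assume "k \<in> {..n}"
    have "s * (jacobi_coeff \<alpha> n k * w ^ k)
        = real d * (4 ^ n * jacobi_coeff \<alpha> n k) * (real B ^ n * w ^ k)"
      unfolding s_def by (simp add: power_mult_distrib)
    also have "\<dots> \<in> \<int>" using \<open>k \<in> {..n}\<close> by (intro Ints_mult[OF Ints_mult[OF _ coeff_int] w_int]) auto
    finally show "s * (jacobi_coeff \<alpha> n k * w ^ k) \<in> \<int>" .
  qed
  then obtain Q :: int where Q: "q = of_int Q" by (rule Ints_cases)
  have "p \<in> \<int>" unfolding p_def
  proof (intro Ints_sum)
    fix k j assume kj: "k \<in> {..n}" "j \<in> {..<k}"
    have "s * (jacobi_coeff \<alpha> n k * (w ^ (k - 1 - j) / (\<alpha> + real j)))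
        = (real d / (\<alpha> + real j)) * (4 ^ n * jacobi_coeff \<alpha> n k) * (real B ^ n * w ^ (k - 1 - j))"
      unfolding s_def by (simp add: power_mult_distrib)
    also have "\<dots> \<in> \<int>" using kj by (intro Ints_mult[OF Ints_mult[OF denom_int coeff_int] w_int]) auto
    finally show "s * (jacobi_coeff \<alpha> n k * (w ^ (k - 1 - j) / (\<alpha> + real j))) \<in> \<int>" .
  qed
  then obtain P :: int where P: "p = of_int P" by (rule Ints_cases)
  have "(\<Sum>k\<le>n. jacobi_coeff \<alpha> n k * beta_series z (\<alpha> + real k))
      = (\<Sum>k\<le>n. jacobi_coeff \<alpha> n k * (w ^ k * beta_series z \<alpha>
          + (\<Sum>j<k. w ^ (k - 1 - j) / (\<alpha> + real j)) / z))"
    unfolding w_def by (intro sum.cong refl arg_cong2[of _ _ _ _ "(*)"] beta_series_shift_nat \<alpha>1(1) z)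
  then have "z * s * (\<Sum>k\<le>n. jacobi_coeff \<alpha> n k * beta_series z (\<alpha> + real k))
      = (\<Sum>k\<le>n. s * (jacobi_coeff \<alpha> n k * w ^ k) * (z * beta_series z \<alpha>)
          + (\<Sum>j<k. s * (jacobi_coeff \<alpha> n k * (w ^ (k - 1 - j) / (\<alpha> + real j)))))"
  proof -
    have "z * s * (c * (u * F + S / z)) = s * (c * u) * (z * F) + s * (c * S)" for c u F S
      using z by (simp add: field_simps)
    then show ?thesis
      using \<open>(\<Sum>k\<le>n. jacobi_coeff \<alpha> n k * beta_series z (\<alpha> + real k)) = _\<close>
      by (simp only: sum_distrib_left)
  qed
  then have eq: "z * s * (\<Sum>k\<le>n. jacobi_coeff \<alpha> n k * beta_series z (\<alpha> + real k))
      = of_int Q * (z * beta_series z \<alpha>) + of_int P"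
    unfolding Q[symmetric] P[symmetric] q_def p_def sum.distrib sum_distrib_right .
  have w_le: "\<bar>w\<bar> ^ k \<le> (real N / real B) ^ n" if "k \<le> n" for k
  proof -
    have w: "\<bar>w\<bar> \<le> real N / real B" unfolding w_def z_def using BN by (simp add: abs_le_iff field_simps)
    have "\<bar>w\<bar> ^ k \<le> (real N / real B) ^ k" using w by (intro power_mono) auto
    also have "\<dots> \<le> (real N / real B) ^ n" using that BN by (intro power_increasing) auto
    finally show ?thesis .
  qed
  have "\<bar>q\<bar> \<le> (\<Sum>k\<le>n. \<bar>s * (jacobi_coeff \<alpha> n k * w ^ k)\<bar>)" unfolding q_def by (rule sum_abs)
  also have "\<dots> \<le> (\<Sum>k\<le>n. s * (\<bar>jacobi_coeff \<alpha> n k\<bar> * (real N / real B) ^ n))"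
  proof (rule sum_mono)
    fix k assume "k \<in> {..n}"
    have "s \<ge> 0" unfolding s_def by simp
    then show "\<bar>s * (jacobi_coeff \<alpha> n k * w ^ k)\<bar> \<le> s * (\<bar>jacobi_coeff \<alpha> n k\<bar> * (real N / real B) ^ n)"
      using w_le[of k] \<open>k \<in> {..n}\<close> by (simp add: abs_mult power_abs mult_left_mono)
  qed
  also have "\<dots> = s * (real N / real B) ^ n * (\<Sum>k\<le>n. \<bar>jacobi_coeff \<alpha> n k\<bar>)"
    by (simp add: sum_distrib_left mult_ac)
  also have "\<dots> \<le> s * (real N / real B) ^ n * 8 ^ n"
    using jacobi_coeff_sum_le[OF \<alpha>1, of n] unfolding s_def by (intro mult_left_mono) auto
  also have "\<dots> = (32 * real N) ^ n * real d"
  proof -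
    have "4 * real B * (real N / real B) * 8 = 32 * real N" using BN by simp
    then have "(4 * real B) ^ n * (real N / real B) ^ n * 8 ^ n = (32 * real N) ^ n"
      by (metis power_mult_distrib)
    then show ?thesis unfolding s_def by (metis mult.assoc mult.commute)
  qed
  also have "\<dots> \<le> (32 * real N) ^ n * 256 ^ n"
    using of_nat_mono[OF d(2), where 'a = real] by (intro mult_left_mono) auto
  also have "\<dots> = (32 * real N * 256) ^ n" by (simp only: power_mult_distrib)
  also have "\<dots> = (8192 * real N) ^ n" by simp
  finally have Qle: "\<bar>of_int Q\<bar> \<le> (8192 * real N) ^ n" unfolding Q .
  show thesis
  proof (rule that[of "real d" Q P])
    show "1 \<le> real d" "real d \<le> 256 ^ n"
      using d(1) of_nat_mono[OF d(2), where 'a = real] by simp_all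
    show "of_int Q * (z * beta_series z \<alpha>) + of_int P
       = z * (4 * real B) ^ n * real d * (\<Sum>k\<le>n. jacobi_coeff \<alpha> n k * beta_series z (\<alpha> + real k))"
      using eq unfolding s_def by (simp add: mult.assoc)
  qed (rule Qle)
qed

text \<open>
  The factors \<open>g\<close> and \<open>h\<close> allow for the rational factor between \<open>\<xi>\<close> and the series. They affect only
  the constants in front of the powers in \<open>irrationality_measure_criterion\<close>, so they may grow
  with \<open>N\<close>, whereas \<open>K = 8192 B^2\<close> must not.
\<close>
lemma beta_series_measure:
  fixes \<alpha> \<xi> :: real and B N g h :: nat
  assumes \<alpha>: "\<alpha> = 1 \<or> \<alpha> = 1/2" and BN: "0 < B" "B < N" and gh: "0 < g" "0 < h"
    and \<xi>: "real g * \<xi> = real h * (real B / real N * beta_series (real B / real N) \<alpha>)"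
    and large: "real N powr (1/100) \<ge> (8192 * (real B)\<^sup>2) ^ 5"
  shows "\<exists>c>0. \<forall>(q::nat)\<ge>1. \<forall>p::int. \<bar>real q * \<xi> - of_int p\<bar> \<ge> c / real q powr (101/100)"
proof -
  define z where "z = real B / real N"
  define K where "K = 8192 * (real B)\<^sup>2"
  define l where "l n = (\<Sum>k\<le>n. jacobi_coeff \<alpha> n k * beta_series z (\<alpha> + real k))" for n
  have \<alpha>1: "0 < \<alpha>" "\<alpha> \<le> 1" using \<alpha> by auto
  have z: "0 < z" "z < 1" unfolding z_def using BN by auto
  have l: "(z / 12) ^ n \<le> l n" "l n \<le> (8 * z) ^ n / (\<alpha> * (1 - z))" for n
    unfolding l_def by (rule jacobi_remainder[OF \<alpha>1 z])+
  have "\<exists>Q P :: int. \<exists>D::real. 1 \<le> D \<and> D \<le> 256 ^ n \<and> \<bar>of_int Q\<bar> \<le> (8192 * real N) ^ n \<and>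
      of_int Q * (z * beta_series z \<alpha>) + of_int P = z * (4 * real B) ^ n * D * l n" for n
    unfolding l_def z_def by (rule beta_series_approximation[OF \<alpha> BN, of n]) blast
  then obtain Q P :: "nat \<Rightarrow> int" and D :: "nat \<Rightarrow> real" where
    D: "\<And>n. 1 \<le> D n" "\<And>n. D n \<le> 256 ^ n" and Q: "\<And>n. \<bar>of_int (Q n)\<bar> \<le> (8192 * real N) ^ n"
    and QP: "\<And>n. of_int (Q n) * (z * beta_series z \<alpha>) + of_int (P n) = z * (4 * real B) ^ n * D n * l n"
    by metis
  have B1: "(real B)\<^sup>2 \<ge> 1" using BN by simp
  have K: "K \<ge> 2" unfolding K_def using B1 by simp
  have form: "of_int (int g * Q n) * \<xi> - of_int (- int h * P n) = real h * z * ((4 * real B) ^ n * D n * l n)" for n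
  proof -
    have "of_int (int g * Q n) * \<xi> - of_int (- int h * P n) = of_int (Q n) * (real g * \<xi>) + real h * of_int (P n)"
      by simp
    also have "\<dots> = real h * (of_int (Q n) * (z * beta_series z \<alpha>) + of_int (P n))"
      unfolding \<xi> z_def by (simp add: algebra_simps)
    finally show ?thesis unfolding QP by (simp add: mult_ac)
  qed
  define C where "C = max (real g) (real h * z / (\<alpha> * (1 - z)))"
  show ?thesis
  proof (rule irrationality_measure_criterion)
    show "K \<ge> 2" by (rule K)
    show "real N powr (1/100) \<ge> K ^ 5" using large by (simp add: K_def)
    show "real N \<ge> 1" using BN by simp
    show "real h * z > 0" using gh z by simp
    show "C > 0" unfolding C_def using gh by (simp add: less_max_iff_disj)
    show "\<bar>of_int (int g * Q n)\<bar> \<le> C * (K * real N) ^ n" for n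
    proof -
      have "\<bar>of_int (int g * Q n)\<bar> = real g * \<bar>of_int (Q n)\<bar>" by (simp add: abs_mult)
      also have "\<dots> \<le> C * (8192 * real N) ^ n"
        using Q[of n] by (intro mult_mono) (auto simp: C_def)
      also have "\<dots> \<le> C * (K * real N) ^ n"
        unfolding K_def using B1 by (intro mult_left_mono power_mono mult_right_mono) (auto simp: C_def)
      finally show ?thesis .
    qed
    have l0: "0 \<le> l n" for n using l(1)[of n] z by (meson order_trans zero_le_power divide_nonneg_nonneg less_imp_le zero_le_numeral)
    have abs_form: "\<bar>of_int (int g * Q n) * \<xi> - of_int (- int h * P n)\<bar>
        = real h * z * ((4 * real B) ^ n * D n * l n)" for n
      unfolding form
    proof (rule abs_of_nonneg)
      have "0 \<le> D n" using D(1)[of n] by simp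
      then show "0 \<le> real h * z * ((4 * real B) ^ n * D n * l n)"
        using l0[of n] z by (intro mult_nonneg_nonneg) auto
    qed
    show "\<bar>of_int (int g * Q n) * \<xi> - of_int (- int h * P n)\<bar> \<le> C * (K / real N) ^ n" for n
    proof -
      have "(4 * real B) ^ n * D n * l n \<le> (4 * real B) ^ n * 256 ^ n * ((8 * z) ^ n / (\<alpha> * (1 - z)))"
        using D[of n] l(2)[of n] l0[of n] by (intro mult_mono) auto
      also have "\<dots> = (K / real N) ^ n / (\<alpha> * (1 - z))"
      proof -
        have "4 * real B * 256 * (8 * z) = K / real N"
          unfolding K_def z_def by (simp add: power2_eq_square)
        then have "(4 * real B) ^ n * 256 ^ n * (8 * z) ^ n = (K / real N) ^ n"
          by (metis power_mult_distrib)
        then show ?thesis by simp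
      qed
      finally have "real h * z * ((4 * real B) ^ n * D n * l n) \<le> real h * z * ((K / real N) ^ n / (\<alpha> * (1 - z)))"
        using z by (intro mult_left_mono) auto
      also have "\<dots> = real h * z / (\<alpha> * (1 - z)) * (K / real N) ^ n" by simp
      also have "\<dots> \<le> C * (K / real N) ^ n" unfolding C_def K_def by (intro mult_right_mono) auto
      finally show ?thesis unfolding abs_form .
    qed
    show "real h * z / (K * real N) ^ n \<le> \<bar>of_int (int g * Q n) * \<xi> - of_int (- int h * P n)\<bar>" for n
    proof -
      have "1 / (K * real N) \<le> 4 * real B * (z / 12)"
      proof -
        have "3 \<le> K" unfolding K_def using B1 by linarith
        then have "3 * real N \<le> K * real N" by (intro mult_right_mono) auto
        then have "1 / (K * real N) \<le> 1 / (3 * real N)"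
          using BN \<open>3 \<le> K\<close> by (intro divide_left_mono) auto
        also have "\<dots> \<le> (real B)\<^sup>2 / (3 * real N)" using B1 by (intro divide_right_mono) auto
        finally show ?thesis unfolding z_def by (simp add: power2_eq_square)
      qed
      then have "(1 / (K * real N)) ^ n \<le> (4 * real B * (z / 12)) ^ n"
        using K by (intro power_mono) auto
      also have "\<dots> = (4 * real B) ^ n * 1 * (z / 12) ^ n"
        by (simp only: power_mult_distrib mult_1_right)
      also have "\<dots> \<le> (4 * real B) ^ n * D n * l n"
        using D(1)[of n] l(1)[of n] z by (intro mult_mono) auto
      finally have "real h * z * (1 / (K * real N)) ^ n \<le> real h * z * ((4 * real B) ^ n * D n * l n)"
        using z by (intro mult_left_mono) auto
      then show ?thesis unfolding abs_form by (simp add: power_divide)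
    qed
  qed
qed

section \<open>The logarithm and the arcsine\<close>

lemma ln_eq_beta_series:
  assumes "0 < z" "z < 1"
  shows "z * beta_series z 1 = - ln (1 - z)"
proof -
  have "(\<lambda>i. z * (beta_moment i 1 * z ^ i)) sums (z * beta_series z 1)"
    using assms by (intro sums_mult beta_series_sums) auto
  moreover have "beta_moment i 1 = 1 / real (Suc i)" for i
    unfolding beta_moment_def pochhammer_fact[symmetric] by simp
  ultimately have S: "(\<lambda>i. z ^ Suc i / real (Suc i)) sums (z * beta_series z 1)" by simp
  have "ln (1 - z) = (\<Sum>n. (-1) ^ n * (1 / real (n + 1)) * (1 - z - 1) ^ Suc n)"
    using assms by (intro ln_series) auto
  also have "\<dots> = (\<Sum>n. - (z ^ Suc n / real (Suc n)))"
  proof (rule arg_cong[of _ _ suminf], rule ext)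
    fix n
    have "(-1) ^ n * (- z) ^ n = ((-1) * (- z)) ^ n" by (simp only: power_mult_distrib)
    then have "(-1) ^ n * (- z) ^ n * (z / real (n + 1)) = z ^ n * (z / real (n + 1))" by simp
    then show "(-1) ^ n * (1 / real (n + 1)) * (1 - z - 1) ^ Suc n = - (z ^ Suc n / real (Suc n))"
      by (simp add: mult_ac)
  qed
  also have "\<dots> = - (z * beta_series z 1)"
    using sums_minus[OF S] by (simp add: sums_iff)
  finally show ?thesis by simp
qed

text \<open>
  The recursion \<open>(i + 3/2) c (i+1) = (i + 1) c i\<close> of the coefficients, as a differential equation.
\<close>
lemma beta_series_ode:
  assumes z: "0 \<le> z" "z < 1"
  obtains F' where "((\<lambda>z. beta_series z (1/2)) has_real_derivative F') (at z)"
    "z * F' + beta_series z (1/2) / 2 = 1 + z * (z * F' + beta_series z (1/2))"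
proof -
  define c where "c i = beta_moment i (1/2)" for i
  define F where "F = beta_series z (1/2)"
  have sF: "(\<lambda>i. c i * z ^ i) sums F" unfolding c_def F_def by (rule beta_series_sums) (use z in auto)
  define K where "K = (1 + z) / 2"
  have K: "0 \<le> K" "K < 1" "norm z < norm K" using z unfolding K_def by auto
  define F' where "F' = (\<Sum>i. diffs c i * z ^ i)"
  have "summable (\<lambda>i. c i * K ^ i)"
    unfolding c_def using beta_series_sums[of "1/2" K] K by (simp add: sums_iff)
  note sK = this
  have "((\<lambda>z. beta_series z (1/2)) has_real_derivative F') (at z)"
    using termdiffs_strong[OF sK K(3)] unfolding F'_def beta_series_def c_def .
  moreover have "z * F' + F / 2 = 1 + z * (z * F' + F)"
  proof -
    have sd: "summable (\<lambda>i. diffs c i * z ^ i)"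
      using termdiff_converges[of z K c] K sK
      by (metis summable_norm_cancel abs_of_nonneg real_norm_def powser_inside)
    then have "(\<lambda>i. z * (diffs c i * z ^ i)) sums (z * F')"
      unfolding F'_def by (intro sums_mult summable_sums)
    then have "(\<lambda>i. real (Suc i) * c (Suc i) * z ^ Suc i) sums (z * F')"
      by (simp add: diffs_def mult_ac)
    then have s1: "(\<lambda>i. real i * c i * z ^ i) sums (z * F')"
      by (subst (asm) sums_Suc_iff) simp
    have "(\<lambda>i. real i * c i * z ^ i + c i * z ^ i / 2) sums (z * F' + F / 2)"
      by (intro sums_add s1 sums_divide sF)
    then have "(\<lambda>i. real (Suc i) * c (Suc i) * z ^ Suc i + c (Suc i) * z ^ Suc i / 2) sums (z * F' + F / 2 - 1)"
      by (subst sums_Suc_iff) (simp add: c_def)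
    moreover have "real (Suc i) * c (Suc i) * z ^ Suc i + c (Suc i) * z ^ Suc i / 2
        = z * (real i * c i * z ^ i + c i * z ^ i)" for i
    proof -
      have "c (Suc i) * (1/2 + real i + 1) = (real i + 1) * c i"
        unfolding c_def by (rule beta_moment_Suc_left) simp
      then have "(real (Suc i) * c (Suc i) + c (Suc i) / 2) * z ^ Suc i = ((real i + 1) * c i) * z ^ Suc i"
        by (simp add: algebra_simps)
      then show ?thesis by (simp add: algebra_simps)
    qed
    ultimately have "(\<lambda>i. z * (real i * c i * z ^ i + c i * z ^ i)) sums (z * F' + F / 2 - 1)" by simp
    moreover have "(\<lambda>i. z * (real i * c i * z ^ i + c i * z ^ i)) sums (z * (z * F' + F))"
      by (intro sums_mult sums_add s1 sF)
    ultimately have "z * F' + F / 2 - 1 = z * (z * F' + F)" by (rule sums_unique2)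
    then show ?thesis by simp
  qed
  ultimately show thesis using that unfolding F_def by blast
qed

text \<open>
  The difference of the two sides has derivative 0 by \<open>beta_series_ode\<close> and vanishes at 0.
\<close>
lemma arcsin_eq_beta_series:
  assumes y: "0 < y" "y < 1"
  shows "arcsin y = y / 2 * beta_series (y\<^sup>2) (1/2) * sqrt (1 - y\<^sup>2)"
proof -
  define G where "G u = u / 2 * beta_series (u\<^sup>2) (1/2) * sqrt (1 - u\<^sup>2) - arcsin u" for u
  have D: "(G has_real_derivative 0) (at u)" if u: "-1 < u" "u < 1" for u
  proof -
    have u2: "0 \<le> u\<^sup>2" "u\<^sup>2 < 1" using u by (simp_all add: abs_square_less_1 abs_less_iff)
    obtain F' where F': "((\<lambda>z. beta_series z (1/2)) has_real_derivative F') (at (u\<^sup>2))"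
      "u\<^sup>2 * F' + beta_series (u\<^sup>2) (1/2) / 2 = 1 + u\<^sup>2 * (u\<^sup>2 * F' + beta_series (u\<^sup>2) (1/2))"
      by (rule beta_series_ode[OF u2])
    let ?F = "beta_series (u\<^sup>2) (1/2)"
    let ?r = "sqrt (1 - u\<^sup>2)"
    have r: "?r > 0" "?r * ?r = 1 - u\<^sup>2" using u2 by simp_all
    have comp: "((\<lambda>u. beta_series (u\<^sup>2) (1/2)) has_real_derivative F' * (2 * u)) (at u)"
    proof -
      have "((\<lambda>u. u\<^sup>2) has_real_derivative 2 * u) (at u)" by (auto intro!: derivative_eq_intros)
      then show ?thesis
        by (rule DERIV_chain2[where f = "\<lambda>z. beta_series z (1/2)" and g = "\<lambda>u. u\<^sup>2", OF F'(1)])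
    qed
    have half: "((\<lambda>u. u / 2) has_real_derivative 1/2) (at u)"
      by (auto intro!: derivative_eq_intros)
    have root: "((\<lambda>u. sqrt (1 - u\<^sup>2)) has_real_derivative (- u / ?r)) (at u)"
      using u2 by (auto intro!: derivative_eq_intros simp: field_simps)
    have "(G has_real_derivative
        ((1/2 * ?F + F' * (2 * u) * (u / 2)) * ?r + (- u / ?r) * (u / 2 * ?F)) - inverse ?r) (at u)"
      unfolding G_def by (intro DERIV_diff DERIV_mult half comp root DERIV_arcsin u)
    moreover have "((1/2 * ?F + F' * (2 * u) * (u / 2)) * ?r + (- u / ?r) * (u / 2 * ?F)) - inverse ?r = 0"
      (is "?E = 0")
    proof -
      have "?E * ?r = (1/2 * ?F + u\<^sup>2 * F') * (?r * ?r) - u\<^sup>2 / 2 * ?F - 1"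
      proof -
        have "((1/2 * f + F' * (2 * u) * (u / 2)) * s + (- u / s) * (u / 2 * f) - inverse s) * s
            = (1/2 * f + u\<^sup>2 * F') * (s * s) - u\<^sup>2 / 2 * f - 1" if "s > 0" for f s :: real
          using that by (simp add: field_simps power2_eq_square)
        then show ?thesis using r(1) by blast
      qed
      also have "\<dots> = (u\<^sup>2 * F' + ?F / 2) - (1 + u\<^sup>2 * (u\<^sup>2 * F' + ?F))"
        unfolding r(2) by (simp add: algebra_simps diff_divide_distrib)
      also have "\<dots> = 0" using F'(2) by simp
      finally show ?thesis using r(1) by simp
    qed
    ultimately show ?thesis by simp
  qed
  have "G y = G 0"
  proof (rule DERIV_isconst_end[OF y(1)])
    show "continuous_on {0..y} G"
    proof (rule continuous_at_imp_continuous_on, rule ballI)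
      fix u assume "u \<in> {0..y}"
      then have "-1 < u" "u < 1" using y by simp_all
      then show "isCont G u" using DERIV_isCont[OF D] by blast
    qed
    show "(G has_real_derivative 0) (at u)" if "0 < u" "u < y" for u using D[of u] that y by simp
  qed
  then show ?thesis unfolding G_def by simp
qed

text \<open>
  With \<open>z = s / (s + t)\<close> the logarithm is \<open>- ln (1 - z)\<close>. Expanding it in powers of \<open>s / t\<close> instead
  would give a series with alternating signs, to which \<open>jacobi_remainder\<close> does not apply.
\<close>
lemma ln_measure:
  fixes s t :: nat
  assumes st: "0 < s" "0 < t" and large: "real t powr (1/100) \<ge> (8192 * (real s)\<^sup>2) ^ 5"
  shows "\<exists>c>0. \<forall>(q::nat)\<ge>1. \<forall>p::int.
    \<bar>real q * ln (1 + real s / real t) - of_int p\<bar> \<ge> c / real q powr (101/100)"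
proof (rule beta_series_measure[where \<alpha> = 1 and B = s and N = "s + t" and g = 1 and h = 1])
  let ?z = "real s / real (s + t)"
  have z: "0 < ?z" "?z < 1" using st by auto
  have "1 - ?z = inverse (1 + real s / real t)" using st by (simp add: field_simps)
  then have "- ln (1 - ?z) = ln (1 + real s / real t)"
    using st by (simp add: ln_inverse add_pos_pos)
  then show "real 1 * ln (1 + real s / real t) = real 1 * (?z * beta_series ?z 1)"
    using ln_eq_beta_series[OF z] by simp
  have "real t powr (1/100) \<le> real (s + t) powr (1/100)" by (intro powr_mono2) auto
  then show "(8192 * (real s)\<^sup>2) ^ 5 \<le> real (s + t) powr (1/100)" using large by linarith
qed (use st in auto)

text \<open>
  With \<open>y = s / t\<close> the root is \<open>t * sqrt (1 - y^2)\<close>. It removes the irrational factor in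
  \<open>arcsin_eq_beta_series\<close> and leaves a rational multiple of the series at \<open>z = y^2\<close>.
\<close>
lemma arcsin_measure:
  fixes s t :: nat
  assumes st: "0 < s" "s < t" and large: "real t powr (1/100) \<ge> (8192 * ((real s)\<^sup>2)\<^sup>2) ^ 5"
  shows "\<exists>c>0. \<forall>(q::nat)\<ge>1. \<forall>p::int.
    \<bar>real q * (sqrt ((real t)\<^sup>2 - (real s)\<^sup>2) * arcsin (real s / real t)) - of_int p\<bar>
      \<ge> c / real q powr (101/100)"
proof (rule beta_series_measure[where \<alpha> = "1/2" and B = "s\<^sup>2" and N = "t\<^sup>2" and g = "2 * s" and h = "t\<^sup>2 - s\<^sup>2"])
  have lt: "s\<^sup>2 < t\<^sup>2" using st by (intro power_strict_mono) auto
  then show "0 < s\<^sup>2" "s\<^sup>2 < t\<^sup>2" "0 < 2 * s" "0 < t\<^sup>2 - s\<^sup>2" using st by auto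
  define y where "y = real s / real t"
  define r where "r = sqrt (1 - y\<^sup>2)"
  define f where "f = beta_series (y\<^sup>2) (1/2)"
  have y: "0 < y" "y < 1" "real s = real t * y" using st unfolding y_def by auto
  have y2: "real (s\<^sup>2) / real (t\<^sup>2) = y\<^sup>2" unfolding y_def by (simp add: power_divide)
  have h: "real (t\<^sup>2 - s\<^sup>2) = (real t)\<^sup>2 - (real s)\<^sup>2"
    by (simp only: of_nat_diff[OF less_imp_le[OF lt]] of_nat_power)
  have "y\<^sup>2 < 1" using y by (simp add: power_less_one_iff)
  then have rr: "r * r = 1 - y\<^sup>2" unfolding r_def by simp
  have square: "(real t)\<^sup>2 - (real s)\<^sup>2 = (real t)\<^sup>2 * (1 - y\<^sup>2)"
    unfolding y(3) power_mult_distrib right_diff_distrib by simp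
  then have root: "sqrt ((real t)\<^sup>2 - (real s)\<^sup>2) = real t * r"
    unfolding r_def by (simp add: real_sqrt_mult)
  have arc: "arcsin y = y / 2 * f * r"
    unfolding f_def r_def by (rule arcsin_eq_beta_series[OF y(1,2)])
  have "real (2 * s) * (real t * r * (y / 2 * f * r)) = (real t)\<^sup>2 * (r * r) * (y\<^sup>2 * f)"
    by (simp add: y(3) power2_eq_square)
  then show "real (2 * s) * (sqrt ((real t)\<^sup>2 - (real s)\<^sup>2) * arcsin (real s / real t))
      = real (t\<^sup>2 - s\<^sup>2) * (real (s\<^sup>2) / real (t\<^sup>2) * beta_series (real (s\<^sup>2) / real (t\<^sup>2)) (1/2))"
    unfolding h y2 y_def[symmetric] root arc
    unfolding square rr f_def .
  have "real t \<le> real (t\<^sup>2)" using st by (simp add: power2_eq_square)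
  then have "real t powr (1/100) \<le> real (t\<^sup>2) powr (1/100)" by (intro powr_mono2) auto
  then show "(8192 * (real (s\<^sup>2))\<^sup>2) ^ 5 \<le> real (t\<^sup>2) powr (1/100)" using large by simp
qed simp

section \<open>The complexity of the two expansions\<close>

theorem theorem2p2:
  fixes b :: nat and \<epsilon> :: real and s :: int
  assumes "b \<ge> 2" and "\<epsilon> > 0" and "s > 0"
  shows "\<exists>t0::int. \<forall>t::int. t > t0 \<longrightarrow>
      liminf (\<lambda>n. ereal (real (block_complexity n (ln (1 + real_of_int s / real_of_int t)) b) / real n))
        \<ge> ereal (9 / 8 - \<epsilon>) \<and>
      liminf (\<lambda>n. ereal (real (block_complexity n
            (sqrt ((real_of_int t)\<^sup>2 - (real_of_int s)\<^sup>2) * arcsin (real_of_int s / real_of_int t)) b) / real n))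
        \<ge> ereal (9 / 8 - \<epsilon>)"
proof -
  define m where "m = nat s"
  have m: "0 < m" "real_of_int s = real m" using assms unfolding m_def by auto
  define M where "M = (8192 * ((real m)\<^sup>2)\<^sup>2) ^ 5"
  have "(1::real) \<le> (real m)\<^sup>2" using m by simp
  then have "(real m)\<^sup>2 * 1 \<le> (real m)\<^sup>2 * (real m)\<^sup>2" by (intro mult_left_mono) auto
  then have M_ge: "(8192 * (real m)\<^sup>2) ^ 5 \<le> M"
    unfolding M_def power2_eq_square[of "(real m)\<^sup>2"] by (intro power_mono mult_left_mono) auto
  have "M \<ge> 0" unfolding M_def by simp
  \<comment> \<open>\<open>t > M powr 100\<close> is the largeness condition of both measures, \<open>t > s\<close> puts \<open>s / t\<close> into the domain of the arcsine.\<close>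
  define t0 where "t0 = max s \<lceil>M powr 100\<rceil>"
  show ?thesis
  proof (intro exI[of _ t0] allI impI conjI)
    fix t :: int assume t: "t > t0"
    define n where "n = nat t"
    have n: "m < n" "real_of_int t = real n" using t assms(3) unfolding t0_def n_def m_def by auto
    have "M powr 100 \<le> real_of_int t" using t unfolding t0_def by linarith
    then have "(M powr 100) powr (1/100) \<le> real n powr (1/100)" unfolding n(2) by (intro powr_mono2) auto
    moreover have "(M powr 100) powr (1/100) = M"
      using \<open>M \<ge> 0\<close> by (simp only: powr_powr) simp
    ultimately have large: "M \<le> real n powr (1/100)" by simp
    show "liminf (\<lambda>n. ereal (real (block_complexity n (ln (1 + real_of_int s / real_of_int t)) b) / real n))
        \<ge> ereal (9 / 8 - \<epsilon>)"
      unfolding m n using m n M_ge large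
      by (intro liminf_complexity[OF assms(1,2)] ln_measure) auto
    show "liminf (\<lambda>n. ereal (real (block_complexity n
            (sqrt ((real_of_int t)\<^sup>2 - (real_of_int s)\<^sup>2) * arcsin (real_of_int s / real_of_int t)) b) / real n))
        \<ge> ereal (9 / 8 - \<epsilon>)"
      unfolding m n using m n large
      by (intro liminf_complexity[OF assms(1,2)] arcsin_measure) (auto simp: M_def)
  qed
qed

end
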